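(* Let $m\ge 3$ and let $\Omega\subset\mathbb{S}^m$ be an open domain with $\partial\Omega=\mathcal{V}_1\cup\mathcal{V}_2$, where $\mathcal{V}_1,\mathcal{V}_2$ are disjoint compact submanifolds of $\mathbb{S}^m$ (possibly of dimension zero, and $\mathcal V_2$ possibly empty). Let $\rho\in C^{2,\alpha}(\Omega\cup\mathcal{V}_1)$ and $\sigma=e^{-\rho}$, and assume: (1) $\sigma^2$ extends to a $C^{1,1}$ function on $\overline{\Omega}$; (2) $|\nabla\sigma|^2$ extends to a Lipschitz function on $\overline{\Omega}$. Then there is $t_0>0$ such that for all $t>t_0$ the map $\phi_t:=\phi^{\rho+t}:\Omega\cup\mathcal{V}_1\to\mathbb{H}^{m+1}$ associated to $\rho_t=\rho+t$ is an embedded (injective) horospherically concave hypersurface.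
   Context: $\mathbb{S}^m\subset\mathbb{R}^{m+1}$ is the unit sphere with round metric $g_0$; $\nabla$, $\nabla^2$, $|\cdot|$ are with respect to $g_0$. Let $\mathbb{L}^{m+2}$ be $\mathbb{R}^{m+2}$ with $\langle\!\langle x,y\rangle\!\rangle=-x_0y_0+\sum_{i=1}^{m+1}x_iy_i$, and $\mathbb{H}^{m+1}=\{x:\langle\!\langle x,x\rangle\!\rangle=-1,\ x_0>0\}$. For $\rho\in C^1$ the associated map is $$\phi^\rho(x)=\frac{e^{\rho(x)}}{2}\Big(1+e^{-2\rho(x)}\big(1+|\nabla\rho(x)|^2\big)\Big)(1,x)+e^{-\rho(x)}\big(0,-x+\nabla\rho(x)\big).$$ For a conformal metric $g=e^{2\rho}g_0$ ($m\ge3$), the Schouten tensor is $\mathrm{Sch}(g)=\frac{1}{m-2}\big(\mathrm{Ric}(g)-\frac{R(g)}{2(m-1)}g\big)$; its eigenvalues $\lambda_1,\dots,\lambda_m$ are those of $g^{-1}\mathrm{Sch}(g)$. On the sphere, $\mathrm{Sch}(g)=\tfrac12 g_0-\nabla^2\rho+d\rho\otimes d\rho-\tfrac12|\nabla\rho|^2g_0$. The map $\phi^\rho$ ($\rho\in C^2$) is called a horospherically concave hypersurface when all eigenvalues of the Schouten tensor of $e^{2\rho}g_0$ are $<1/2$; then $\phi^\rho$ is an immersion with unit normal $\eta=\phi^\rho-e^{\rho}(1,x)$ whose principal curvatures $\kappa_i>-1$ satisfy $\lambda_i=\tfrac12-\tfrac1{1+\kappa_i}$. *)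

theory Defs
  imports "HOL-Analysis.Analysis"
begin

text \<open>The ambient space R^(m+1) is an abstract euclidean space 'a with DIM('a) = m+1;
  the unit sphere S^m is sphere 0 1.  Functions on (subsets of) the sphere are
  differentiated through their 0-homogeneous extension to the cone over their domain.\<close>

definition hext :: "('a::euclidean_space \<Rightarrow> real) \<Rightarrow> 'a \<Rightarrow> real" where
  "hext f y = f (y /\<^sub>R norm y)"

definition scone :: "'a::euclidean_space set \<Rightarrow> 'a set" where
  "scone A = {y. y \<noteq> 0 \<and> y /\<^sub>R norm y \<in> A}"

definition sgrad :: "('a::euclidean_space \<Rightarrow> real) \<Rightarrow> 'a set \<Rightarrow> 'a \<Rightarrow> 'a" where
  "sgrad f A x = (\<Sum>b\<in>Basis. frechet_derivative (hext f) (at x within scone A) b *\<^sub>R b)"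

text \<open>Spherical (covariant) Hessian of f on A at x, evaluated on tangent vectors u v;
  for a 0-homogeneous extension it coincides with the Euclidean second derivative.\<close>
definition shess :: "('a::euclidean_space \<Rightarrow> real) \<Rightarrow> 'a set \<Rightarrow> 'a \<Rightarrow> 'a \<Rightarrow> 'a \<Rightarrow> real" where
  "shess f A x u v = frechet_derivative
      (\<lambda>y. frechet_derivative (hext f) (at y within scone A) u) (at x within scone A) v"

text \<open>Schouten tensor of e^(2f) g_0 on the sphere:
  Sch = 1/2 g_0 - Hess f + df (x) df - 1/2 |grad f|^2 g_0.\<close>
definition schouten :: "('a::euclidean_space \<Rightarrow> real) \<Rightarrow> 'a set \<Rightarrow> 'a \<Rightarrow> 'a \<Rightarrow> 'a \<Rightarrow> real" where
  "schouten f A x u v = (1/2) * (u \<bullet> v) - shess f A x u v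
      + (sgrad f A x \<bullet> u) * (sgrad f A x \<bullet> v) - (1/2) * (norm (sgrad f A x))\<^sup>2 * (u \<bullet> v)"

text \<open>Eigenvalues of g^(-1) Sch(g) on T_x S^m = {u. u \<bullet> x = 0}, with g = e^(2f) g_0.\<close>
definition schouten_eigenvalues :: "('a::euclidean_space \<Rightarrow> real) \<Rightarrow> 'a set \<Rightarrow> 'a \<Rightarrow> real set" where
  "schouten_eigenvalues f A x = {lam. \<exists>u. u \<bullet> x = 0 \<and> u \<noteq> 0 \<and>
      (\<forall>v. v \<bullet> x = 0 \<longrightarrow> schouten f A x u v = lam * (exp (2 * f x) * (u \<bullet> v)))}"

definition horo_concave :: "('a::euclidean_space \<Rightarrow> real) \<Rightarrow> 'a set \<Rightarrow> bool" where
  "horo_concave f A \<longleftrightarrow> (\<forall>x\<in>A. \<forall>lam\<in>schouten_eigenvalues f A x. lam < 1/2)"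

definition hyperbolic_space :: "(real \<times> 'a::euclidean_space) set" where
  "hyperbolic_space = {(x0, y). - x0\<^sup>2 + y \<bullet> y = -1 \<and> x0 > 0}"

definition phi :: "('a::euclidean_space \<Rightarrow> real) \<Rightarrow> 'a set \<Rightarrow> 'a \<Rightarrow> real \<times> 'a" where
  "phi f A x = (let c = exp (f x) / 2 * (1 + exp (- 2 * f x) * (1 + (norm (sgrad f A x))\<^sup>2))
               in (c, c *\<^sub>R x + exp (- f x) *\<^sub>R (sgrad f A x - x)))"

fun ck_on :: "nat \<Rightarrow> 'a::real_normed_vector set \<Rightarrow> ('a \<Rightarrow> 'b::real_normed_vector) \<Rightarrow> bool" where
  "ck_on 0 U f = continuous_on U f"
| "ck_on (Suc k) U f = (\<exists>f'. (\<forall>x\<in>U. (f has_derivative f' x) (at x)) \<and>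
                              (\<forall>v. ck_on k U (\<lambda>x. f' x v)))"

definition smooth_on :: "'a::real_normed_vector set \<Rightarrow> ('a \<Rightarrow> 'b::real_normed_vector) \<Rightarrow> bool" where
  "smooth_on U f \<longleftrightarrow> (\<forall>k. ck_on k U f)"

definition emb_submanifold :: "'a::euclidean_space set \<Rightarrow> bool" where
  "emb_submanifold V \<longleftrightarrow> (\<forall>x\<in>V. \<exists>U (\<psi>::'a \<Rightarrow> 'a) L. open U \<and> x \<in> U \<and> subspace L \<and>
      smooth_on U \<psi> \<and> inj_on \<psi> U \<and> open (\<psi> ` U) \<and>
      smooth_on (\<psi> ` U) (inv_into U \<psi>) \<and> \<psi> ` (U \<inter> V) = \<psi> ` U \<inter> L)"

definition compact_submanifold_of_sphere :: "'a::euclidean_space set \<Rightarrow> bool" where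
  "compact_submanifold_of_sphere V \<longleftrightarrow> compact V \<and> V \<subseteq> sphere 0 1 \<and> emb_submanifold V"

text \<open>rho \<in> C^(2,alpha)(A) for A \<subseteq> S^m, locally up to the boundary: near each point of A the
  homogeneous extension of rho agrees (on the cone over A) with a C^2 function whose second
  derivative is alpha-Hoelder.\<close>
definition c2alpha_on :: "real \<Rightarrow> 'a::euclidean_space set \<Rightarrow> ('a \<Rightarrow> real) \<Rightarrow> bool" where
  "c2alpha_on \<alpha> A f \<longleftrightarrow> (\<forall>x\<in>A. \<exists>r>0. \<exists>g g1 g2.
      (\<forall>y\<in>ball x r. (g has_derivative g1 y) (at y)) \<and>
      (\<forall>y\<in>ball x r. \<forall>u. ((\<lambda>z. g1 z u) has_derivative g2 y u) (at y)) \<and>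
      (\<exists>C. \<forall>y\<in>ball x r. \<forall>z\<in>ball x r. \<forall>u v.
          \<bar>g2 y u v - g2 z u v\<bar> \<le> C * norm u * norm v * dist y z powr \<alpha>) \<and>
      (\<forall>y\<in>ball x r \<inter> scone A. g y = hext f y))"

text \<open>f (defined on the open set \<Omega> \<subseteq> S^m) extends to a C^(1,1) function on the closure of \<Omega>
  (Gilbarg-Trudinger convention: f and its gradient extend continuously to the closure and
  the gradient is Lipschitz on \<Omega>).\<close>
definition c11_closure :: "'a::euclidean_space set \<Rightarrow> ('a \<Rightarrow> real) \<Rightarrow> bool" where
  "c11_closure \<Omega> f \<longleftrightarrow>
     (\<exists>F. continuous_on (closure \<Omega>) F \<and> (\<forall>x\<in>\<Omega>. F x = f x)) \<and>
     (\<exists>G. continuous_on (closure \<Omega>) G \<and> (\<forall>x\<in>\<Omega>. G x = sgrad f \<Omega> x)) \<and>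
     (\<exists>L. L-lipschitz_on \<Omega> (sgrad f \<Omega>))"

end

theory Submission
  imports Defs
begin

text \<open>
  Write \<open>\<sigma> = exp (- \<rho>)\<close>, \<open>Q = \<sigma>\<^sup>2 + |\<nabla>\<sigma>|\<^sup>2\<close> and \<open>W = (Q - 2 \<sigma>\<^sup>2) x - \<nabla>(\<sigma>\<^sup>2)\<close>. With
  \<open>\<epsilon> = exp (- 2 t)\<close>, the map \<open>\<phi>\<^sub>t\<close> is a multiple of \<open>(1 + \<epsilon> Q, x + \<epsilon> W)\<close>. If \<open>x\<close> and \<open>y\<close> have the
  same image, represented by a point \<open>z\<close> of the unit ball in the projective model of hyperbolic
  space, then \<open>x - y = \<epsilon> ((Q x - Q y) z - (W x - W y))\<close>; as \<open>Q\<close> and \<open>W\<close> are Lipschitz, this forces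
  \<open>x = y\<close> for large \<open>t\<close>. Similarly \<open>\<sigma>\<^sup>2 Sch \<le> (\<nabla>\<^sup>2(\<sigma>\<^sup>2) + \<sigma>\<^sup>2 g\<^sub>0) / 2\<close>, which is bounded because \<open>\<nabla>(\<sigma>\<^sup>2)\<close> is
  Lipschitz, whereas the metric grows like \<open>exp (2 t)\<close>.

  Two points rest on the boundary being a submanifold: the derivative within the domain is unique
  at boundary points, and a function on \<open>\<Omega>\<close> with bounded gradient and a continuous extension to
  the closure is Lipschitz. Both follow from the existence, near each boundary point, of a direction
  \<open>w\<close> such that lines in directions close to \<open>w\<close> cross the boundary at most once.
\<close>

section \<open>Strict derivatives and charts\<close>

definition strict_derivative_at ::
    "('a::real_normed_vector \<Rightarrow> 'b::real_normed_vector) \<Rightarrow> ('a \<Rightarrow> 'b) \<Rightarrow> 'a \<Rightarrow> bool" where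
  "strict_derivative_at f D x \<longleftrightarrow> bounded_linear D \<and>
     (\<forall>e>0. \<exists>d>0. \<forall>p\<in>ball x d. \<forall>q\<in>ball x d. norm (f p - f q - D (p - q)) \<le> e * norm (p - q))"

lemma continuous_derivative_onorm_near:
  fixes f :: "'a::euclidean_space \<Rightarrow> 'b::real_normed_vector"
  assumes U: "open U" "x \<in> U" and deriv: "\<And>y. y \<in> U \<Longrightarrow> (f has_derivative f' y) (at y)"
    and cont: "\<And>v. continuous_on U (\<lambda>y. f' y v)" and e_pos: "e > 0"
  obtains d where "d > 0" "ball x d \<subseteq> U" "\<And>y. y \<in> ball x d \<Longrightarrow> onorm (f' y - f' x) \<le> e"
proof -
  define B where "B y = Blinfun (f' y)" for y
  have B_apply: "blinfun_apply (B y) = f' y" if "y \<in> U" for y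
    using has_derivative_bounded_linear[OF deriv[OF that]]
    by (simp add: B_def bounded_linear_Blinfun_apply)
  have "continuous_on U (\<lambda>y. blinfun_apply (B y) v)" for v
    using cont[of v] by (simp add: B_apply cong: continuous_on_cong)
  then have "continuous_on U B"
    by (intro continuous_on_blinfun_componentwise)
  then have "isCont B x"
    using U by (simp add: continuous_on_eq_continuous_at)
  then obtain d1 where d1: "d1 > 0" "\<And>y. dist y x < d1 \<Longrightarrow> dist (B y) (B x) < e"
    using e_pos unfolding continuous_at_eps_delta by blast
  obtain d2 where d2: "d2 > 0" "ball x d2 \<subseteq> U"
    using U open_contains_ball by blast
  have "onorm (f' y - f' x) \<le> e" if "y \<in> ball x (min d1 d2)" for y
  proof -
    have "norm (B y - B x) \<le> e"
      using d1(2)[of y] that by (simp add: dist_norm dist_commute norm_minus_commute)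
    moreover have "norm (B y - B x) = onorm (f' y - f' x)"
      using that d2(2) U(2)
      by (simp add: norm_blinfun.rep_eq minus_blinfun.rep_eq B_apply subset_iff fun_diff_def)
    ultimately show ?thesis by simp
  qed
  moreover have "ball x (min d1 d2) \<subseteq> U" "min d1 d2 > 0" using d1(1) d2 by auto
  ultimately show ?thesis using that by blast
qed

lemma ck_on_imp_strict_derivative_at:
  fixes f :: "'a::euclidean_space \<Rightarrow> 'b::real_normed_vector"
  assumes U: "open U" "x \<in> U" and C1: "ck_on (Suc 0) U f"
  obtains D where "strict_derivative_at f D x"
proof -
  obtain f' where deriv: "\<And>y. y \<in> U \<Longrightarrow> (f has_derivative f' y) (at y)"
    and cont: "\<And>v. continuous_on U (\<lambda>y. f' y v)"
    using C1 by auto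
  have "\<exists>d>0. \<forall>p\<in>ball x d. \<forall>q\<in>ball x d. norm (f p - f q - f' x (p - q)) \<le> e * norm (p - q)"
    if "e > 0" for e
  proof -
    obtain d where d_pos: "d > 0" and ball: "ball x d \<subseteq> U"
      and onorm_le: "\<And>y. y \<in> ball x d \<Longrightarrow> onorm (f' y - f' x) \<le> e"
      using continuous_derivative_onorm_near[OF U deriv cont \<open>e > 0\<close>] by metis
    have "norm (f p - f q - f' x (p - q)) \<le> norm (p - q) * e"
      if pq: "p \<in> ball x d" "q \<in> ball x d" for p q
    proof (rule differentiable_bound_linearization[where S = "ball x d"])
      show "q + t *\<^sub>R (p - q) \<in> ball x d" if "t \<in> {0..1}" for t
        using convexD_alt[OF convex_ball pq(2,1), of t] that by (simp add: algebra_simps)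
      show "(f has_derivative f' y) (at y within ball x d)" if "y \<in> ball x d" for y
        using deriv ball that by (blast intro: has_derivative_at_withinI)
    qed (use onorm_le d_pos in auto)
    then show ?thesis using d_pos by (metis mult.commute)
  qed
  then show ?thesis
    using that[of "f' x"] has_derivative_bounded_linear[OF deriv[OF U(2)]]
    by (simp add: strict_derivative_at_def)
qed

lemma strict_derivative_at_imp_lipschitz:
  assumes "strict_derivative_at f D x"
  obtains K d where "K > 0" "d > 0" "K-lipschitz_on (ball x d) f"
proof -
  have bounded_lin: "bounded_linear D" using assms by (simp add: strict_derivative_at_def)
  obtain d where near_linear: "d > 0"
    "\<And>p q. p \<in> ball x d \<Longrightarrow> q \<in> ball x d \<Longrightarrow> norm (f p - f q - D (p - q)) \<le> norm (p - q)"
    using assms unfolding strict_derivative_at_def by (metis mult_1 zero_less_one)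
  have "norm (f p - f q) \<le> (1 + onorm D) * norm (p - q)" if "p \<in> ball x d" "q \<in> ball x d" for p q
    using near_linear(2)[OF that] onorm[OF bounded_lin, of "p - q"]
      norm_triangle_sub[of "f p - f q" "D (p - q)"]
    by (simp add: algebra_simps)
  moreover have "1 + onorm D > 0" using onorm_pos_le[OF bounded_lin] by linarith
  ultimately show ?thesis
    using that[of "1 + onorm D" d] near_linear(1) by (simp add: lipschitz_on_def dist_norm)
qed

lemma invariance_of_domain_subspace_sphere:
  fixes f :: "'a::euclidean_space \<Rightarrow> 'b::euclidean_space"
  assumes openin_S: "openin (top_of_set L) S" and subspace_L: "subspace L" "DIM('b) \<le> dim L + 1"
    and embedding: "continuous_on S f" "f ` S \<subseteq> sphere a r" "inj_on f S" and r_pos: "0 < r"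
  shows "openin (top_of_set (sphere a r)) (f ` S)"
proof (cases "f ` S = sphere a r")
  case False
  then obtain b where puncture: "b \<in> sphere a r" "b \<notin> f ` S" using embedding(2) by blast
  obtain c :: 'b where c_basis: "c \<in> Basis" using nonempty_Basis by blast
  define P where "P = {z. c \<bullet> z = 0}"
  have hyperplane: "subspace P" "dim P = DIM('b) - 1"
    using c_basis by (simp_all add: P_def subspace_hyperplane dim_hyperplane nonzero_Basis)
  have "(sphere a r - {b}) homeomorphic P"
    unfolding P_def using r_pos puncture(1) c_basis
    by (intro homeomorphic_punctured_sphere_hyperplane) auto
  then obtain h k where stereographic: "homeomorphism (sphere a r - {b}) P h k"
    unfolding homeomorphic_def by blast
  have image_subset: "f ` S \<subseteq> sphere a r - {b}" using embedding(2) puncture(2) by blast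
  have k_inverse: "k (h (f x)) = f x" if "x \<in> S" for x
    using homeomorphism_apply1[OF stereographic] image_subset that by blast
  have "openin (top_of_set P) ((h \<circ> f) ` S)"
  proof (rule invariance_of_domain_subspaces[OF openin_S subspace_L(1) hyperplane(1)])
    show "continuous_on S (h \<circ> f)"
      using embedding(1) image_subset homeomorphism_cont1[OF stereographic]
      by (meson continuous_on_compose continuous_on_subset)
    show "inj_on (h \<circ> f) S"
      using embedding(3) k_inverse by (intro comp_inj_on) (auto intro: inj_on_inverseI[where g = k])
    show "h \<circ> f \<in> S \<rightarrow> P"
      unfolding Pi_iff comp_apply using image_subset homeomorphism_image1[OF stereographic] by blast
  qed (use subspace_L(2) hyperplane(2) in simp)
  then have "openin (top_of_set (sphere a r - {b})) (k ` (h \<circ> f) ` S)"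
    by (rule homeomorphism_imp_open_map[OF homeomorphism_symD[OF stereographic]])
  moreover have "k ` (h \<circ> f) ` S = f ` S"
    unfolding image_image by (rule image_cong) (simp_all add: k_inverse)
  moreover have "openin (top_of_set (sphere a r)) (sphere a r - {b})"
    by (intro openin_delete openin_subtopology_self)
  ultimately show ?thesis
    using openin_trans by metis
qed simp

text \<open>In classical language, \<open>T\<close> contains the paratingent cone of \<open>V\<close> at \<open>x\<close>.\<close>

definition approximates_secants :: "'a::real_normed_vector set \<Rightarrow> 'a set \<Rightarrow> 'a \<Rightarrow> bool" where
  "approximates_secants T V x \<longleftrightarrow>
     (\<forall>e>0. \<exists>d>0. \<forall>p\<in>V \<inter> ball x d. \<forall>q\<in>V \<inter> ball x d. \<exists>v\<in>T. norm (p - q - v) \<le> e * norm (p - q))"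

locale flat_chart =
  fixes V U :: "'a::euclidean_space set" and \<psi> :: "'a \<Rightarrow> 'a" and L :: "'a set"
  assumes open_dom: "open U" and subspace: "subspace L" and smooth: "smooth_on U \<psi>"
    and inj: "inj_on \<psi> U" and open_image: "open (\<psi> ` U)"
    and smooth_inv: "smooth_on (\<psi> ` U) (inv_into U \<psi>)"
    and flat: "\<psi> ` (U \<inter> V) = \<psi> ` U \<inter> L"
begin

lemma inv_chart [simp]: "y \<in> U \<Longrightarrow> inv_into U \<psi> (\<psi> y) = y"
  using inj by simp

lemma ck_on_charts: "ck_on k U \<psi>" "ck_on k (\<psi> ` U) (inv_into U \<psi>)"
  using smooth smooth_inv by (auto simp: smooth_on_def)

lemma codim_1_openin_sphere:
  assumes "V \<subseteq> sphere a r" "0 < r" and "DIM('a) \<le> dim L + 1"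
  shows "openin (top_of_set (sphere a r)) (U \<inter> V)"
proof -
  have "openin (top_of_set (sphere a r)) (inv_into U \<psi> ` (\<psi> ` U \<inter> L))"
  proof (rule invariance_of_domain_subspace_sphere[OF _ subspace assms(3)])
    show "openin (top_of_set L) (\<psi> ` U \<inter> L)"
      using open_image by (auto simp: openin_open)
    show "continuous_on (\<psi> ` U \<inter> L) (inv_into U \<psi>)"
      using ck_on_charts(2)[of 0] by (auto intro: continuous_on_subset)
    show "inv_into U \<psi> ` (\<psi> ` U \<inter> L) \<subseteq> sphere a r"
      using assms(1) by (auto simp flip: flat)
  qed (use assms in \<open>auto intro: inj_on_inv_into\<close>)
  moreover have "inv_into U \<psi> ` (\<psi> ` U \<inter> L) = U \<inter> V"
    by (force simp flip: flat)
  ultimately show ?thesis by simp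
qed

lemma chart_lipschitz_small_ball:
  assumes "x \<in> U"
  obtains K where "K > 0"
    "\<And>s. s > 0 \<Longrightarrow> \<exists>d>0. ball x d \<subseteq> U \<and> K-lipschitz_on (ball x d) \<psi> \<and> \<psi> ` ball x d \<subseteq> ball (\<psi> x) s"
proof -
  obtain E where "strict_derivative_at \<psi> E x"
    using ck_on_imp_strict_derivative_at[OF open_dom assms ck_on_charts(1)] .
  then obtain K d1 where K_pos: "K > 0" and d1: "d1 > 0" and lip: "K-lipschitz_on (ball x d1) \<psi>"
    by (rule strict_derivative_at_imp_lipschitz)
  obtain d2 where d2: "d2 > 0" "ball x d2 \<subseteq> U" using open_dom assms open_contains_ball by blast
  have "\<exists>d>0. ball x d \<subseteq> U \<and> K-lipschitz_on (ball x d) \<psi> \<and> \<psi> ` ball x d \<subseteq> ball (\<psi> x) s"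
    if "s > 0" for s
  proof -
    define d where "d = min (min d1 d2) (s / K)"
    have "dist (\<psi> x) (\<psi> y) < s" if "y \<in> ball x d" for y
    proof -
      have "dist (\<psi> x) (\<psi> y) \<le> K * dist x y"
        using that d1 by (intro lipschitz_onD[OF lip]) (auto simp: d_def)
      also have "\<dots> < s" using that K_pos by (auto simp: d_def field_simps)
      finally show ?thesis .
    qed
    moreover have "K-lipschitz_on (ball x d) \<psi>"
      using lip by (rule lipschitz_on_subset) (simp add: d_def subset_ball)
    moreover have "ball x d \<subseteq> U" "d > 0"
      using d1 d2 K_pos \<open>s > 0\<close> by (auto simp: d_def)
    ultimately show ?thesis by auto
  qed
  then show ?thesis using that K_pos by blast
qed

lemma approximates_secants_exists:
  assumes "x \<in> U"
  obtains T where "subspace T" "dim T \<le> dim L" "approximates_secants T V x"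
proof -
  obtain K where K_pos: "K > 0" and small_ball:
    "\<And>s. s > 0 \<Longrightarrow> \<exists>d>0. ball x d \<subseteq> U \<and> K-lipschitz_on (ball x d) \<psi> \<and> \<psi> ` ball x d \<subseteq> ball (\<psi> x) s"
    using chart_lipschitz_small_ball[OF assms] by metis
  obtain D where strict: "strict_derivative_at (inv_into U \<psi>) D (\<psi> x)"
    using ck_on_imp_strict_derivative_at[OF open_image imageI[OF assms] ck_on_charts(2)] .
  then have "linear D" by (simp add: strict_derivative_at_def bounded_linear.linear)
  have "\<exists>d>0. \<forall>p\<in>V \<inter> ball x d. \<forall>q\<in>V \<inter> ball x d. \<exists>v\<in>D ` L. norm (p - q - v) \<le> e * norm (p - q)"
    if "e > 0" for e
  proof -
    obtain s where "s > 0" and inv_approx: "\<And>a b. a \<in> ball (\<psi> x) s \<Longrightarrow> b \<in> ball (\<psi> x) s \<Longrightarrow>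
        norm (inv_into U \<psi> a - inv_into U \<psi> b - D (a - b)) \<le> e / K * norm (a - b)"
      using strict \<open>e > 0\<close> K_pos unfolding strict_derivative_at_def by (metis divide_pos_pos)
    then obtain d where "d > 0" and ball: "ball x d \<subseteq> U" "\<psi> ` ball x d \<subseteq> ball (\<psi> x) s"
      and lip: "K-lipschitz_on (ball x d) \<psi>"
      using small_ball by blast
    have image_L: "\<psi> y \<in> L" if "y \<in> V \<inter> ball x d" for y
      using flat ball(1) that by blast
    have "norm (p - q - D (\<psi> p - \<psi> q)) \<le> e * norm (p - q)"
      if pq: "p \<in> V \<inter> ball x d" "q \<in> V \<inter> ball x d" for p q
    proof -
      have "norm (inv_into U \<psi> (\<psi> p) - inv_into U \<psi> (\<psi> q) - D (\<psi> p - \<psi> q)) \<le> e / K * norm (\<psi> p - \<psi> q)"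
        using pq ball(2) by (intro inv_approx) (auto simp: image_subset_iff)
      also have "\<dots> \<le> e / K * (K * norm (p - q))"
        using pq \<open>e > 0\<close> K_pos by (intro mult_left_mono lipschitz_on_normD[OF lip]) auto
      finally show ?thesis using K_pos pq ball(1) by (simp add: subset_iff)
    qed
    moreover have "D (\<psi> p - \<psi> q) \<in> D ` L" if "p \<in> V \<inter> ball x d" "q \<in> V \<inter> ball x d" for p q
      using image_L that subspace by (blast intro: subspace_diff)
    ultimately show ?thesis using \<open>d > 0\<close> by meson
  qed
  then show ?thesis
    using that[of "D ` L"] subspace \<open>linear D\<close>
    by (simp add: approximates_secants_def linear_subspace_image dim_image_le)
qed

end

lemma emb_submanifold_chart:
  assumes "emb_submanifold V" "x \<in> V"
  obtains U \<psi> L where "flat_chart V U \<psi> L" "x \<in> U"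
  using assms unfolding emb_submanifold_def flat_chart_def by metis

section \<open>Transversal directions\<close>

definition secant_slope_le :: "real \<Rightarrow> 'a::real_inner \<Rightarrow> 'a set \<Rightarrow> bool" where
  "secant_slope_le c w M \<longleftrightarrow> (\<forall>p\<in>M. \<forall>q\<in>M. \<bar>(p - q) \<bullet> w\<bar> \<le> c * norm (p - q))"

lemma secant_slope_leD:
  "secant_slope_le c w M \<Longrightarrow> p \<in> M \<Longrightarrow> q \<in> M \<Longrightarrow> \<bar>(p - q) \<bullet> w\<bar> \<le> c * norm (p - q)"
  by (simp add: secant_slope_le_def)

lemma secant_slope_le_subset: "secant_slope_le c w M \<Longrightarrow> N \<subseteq> M \<Longrightarrow> secant_slope_le c w N"
  unfolding secant_slope_le_def by blast

lemma abs_inner_unit_le: "norm w = 1 \<Longrightarrow> \<bar>v \<bullet> w\<bar> \<le> norm v"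
  by (metis Cauchy_Schwarz_ineq2 mult.right_neutral)

lemma approximates_secants_slope_le:
  assumes approx: "approximates_secants T V x" and orthogonal: "norm w = 1" "\<And>v. v \<in> T \<Longrightarrow> v \<bullet> w = 0"
    and c_pos: "c > 0"
  obtains d where "d > 0" "secant_slope_le c w (V \<inter> ball x d)"
proof -
  obtain d where approx_near: "d > 0" "\<And>p q. p \<in> V \<inter> ball x d \<Longrightarrow> q \<in> V \<inter> ball x d \<Longrightarrow>
      \<exists>v\<in>T. norm (p - q - v) \<le> c * norm (p - q)"
    using approx[unfolded approximates_secants_def, rule_format, OF c_pos] by auto
  have "\<bar>(p - q) \<bullet> w\<bar> \<le> c * norm (p - q)" if pq: "p \<in> V \<inter> ball x d" "q \<in> V \<inter> ball x d" for p q
  proof -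
    obtain v where v_close: "v \<in> T" "norm (p - q - v) \<le> c * norm (p - q)"
      using approx_near(2)[OF pq] by blast
    have "(p - q) \<bullet> w = (p - q - v) \<bullet> w"
      using orthogonal(2)[OF v_close(1)] by (simp add: inner_diff_left)
    then show ?thesis using abs_inner_unit_le[OF orthogonal(1), of "p - q - v"] v_close(2) by linarith
  qed
  then show ?thesis using that approx_near(1) by (simp add: secant_slope_le_def)
qed

locale transversal_ball =
  fixes K :: "'a::euclidean_space set" and w c :: 'a and r :: real
  assumes open_K: "open K" and norm_w: "norm w = 1"
    and slope: "secant_slope_le (1/2) w (frontier K \<inter> ball c r)"
begin

definition steep :: "'a \<Rightarrow> bool" where
  "steep v \<longleftrightarrow> norm v < 2 * \<bar>v \<bullet> w\<bar>"

lemma w_inner_w [simp]: "w \<bullet> w = 1"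
  using norm_w by (simp add: dot_square_norm)

lemma steep_scaleR: "steep v \<Longrightarrow> s \<noteq> 0 \<Longrightarrow> steep (s *\<^sub>R v)"
  by (simp add: steep_def abs_mult)

lemma steep_offset:
  assumes "norm (p - q) \<le> d" "0 < d" "\<bar>s\<bar> = 4 * d"
  shows "steep (p + s *\<^sub>R w - q)" "norm (p + s *\<^sub>R w - q) \<le> 5 * d"
proof -
  have split: "p + s *\<^sub>R w - q = (p - q) + s *\<^sub>R w" by simp
  show length: "norm (p + s *\<^sub>R w - q) \<le> 5 * d"
    unfolding split using norm_triangle_ineq[of "p - q" "s *\<^sub>R w"] assms norm_w by simp
  have "3 * d \<le> \<bar>(p + s *\<^sub>R w - q) \<bullet> w\<bar>"
    unfolding split using abs_inner_unit_le[OF norm_w, of "p - q"] assms by (simp add: inner_add_left)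
  then show "steep (p + s *\<^sub>R w - q)" using length assms(2) by (simp add: steep_def)
qed

lemma K_disjoint_frontier: "K \<inter> frontier K = {}"
  using open_K by (auto simp: frontier_def interior_open)

lemma steep_line_frontier_unique:
  assumes steep: "steep v"
    and on_frontier: "p \<in> frontier K \<inter> ball c r" "p + s *\<^sub>R v \<in> frontier K \<inter> ball c r"
  shows "s = 0"
proof (rule ccontr)
  assume "s \<noteq> 0"
  have "\<bar>(p + s *\<^sub>R v - p) \<bullet> w\<bar> \<le> 1/2 * norm (p + s *\<^sub>R v - p)"
    using slope on_frontier(2,1) by (rule secant_slope_leD)
  then show False using steep_scaleR[OF steep \<open>s \<noteq> 0\<close>] by (simp add: steep_def)
qed

lemma steep_segment_frontier_unique:
  assumes steep: "steep (b - a)" and in_ball: "closed_segment a b \<subseteq> ball c r"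
    and on_frontier: "p \<in> closed_segment a b \<inter> frontier K" "q \<in> closed_segment a b \<inter> frontier K"
  shows "p = q"
proof -
  obtain s t where on_line: "p = a + s *\<^sub>R (b - a)" "q = a + t *\<^sub>R (b - a)"
    using on_frontier by (auto simp: in_segment algebra_simps)
  then have "q = p + (t - s) *\<^sub>R (b - a)" by (simp add: scaleR_left_diff_distrib)
  moreover have "p \<in> frontier K \<inter> ball c r" "q \<in> frontier K \<inter> ball c r"
    using on_frontier in_ball by auto
  ultimately have "t - s = 0" using steep_line_frontier_unique[OF steep] by metis
  then show ?thesis using on_line by simp
qed

lemma separated_point_in_frontier:
  assumes steep: "steep (b - a)" and in_ball: "closed_segment a b \<subseteq> ball c r"
    and between: "y \<in> closed_segment a b"
    and sep: "y \<in> K \<and> a \<notin> K \<and> b \<notin> K \<or> y \<notin> K \<and> a \<in> K \<and> b \<in> K"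
  shows "y \<in> frontier K"
proof -
  have "closed_segment y e \<inter> frontier K \<noteq> {}" if "e = a \<or> e = b" for e
    using connected_Int_frontier[of "closed_segment y e" K] sep that by auto
  then obtain p q where cross_a: "p \<in> closed_segment y a" "p \<in> frontier K"
    and cross_b: "q \<in> closed_segment y b" "q \<in> frontier K"
    by blast
  have "p \<in> closed_segment a b" "q \<in> closed_segment a b"
    using cross_a(1) cross_b(1) between subset_closed_segment[of y a a b]
      subset_closed_segment[of y b a b] by auto
  then have "p = q" using steep_segment_frontier_unique[OF steep in_ball] cross_a(2) cross_b(2) by blast
  moreover have "closed_segment a y \<inter> closed_segment y b = {y}"
    using between by (intro Int_closed_segment) simp
  ultimately show ?thesis using cross_a cross_b by (auto simp: closed_segment_commute)
qed

lemma steep_segment_subset_closure: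
  assumes "steep (b - a)" "closed_segment a b \<subseteq> ball c r" "a \<in> K" "b \<in> K"
  shows "closed_segment a b \<subseteq> closure K"
  using separated_point_in_frontier[OF assms(1,2)] assms(3,4) by (auto simp: closure_Un_frontier)

lemma steep_neighbour_mem_open:
  assumes steep: "steep v" and p_mem: "p \<in> K"
    and in_ball: "p \<in> ball c r" "p + v \<in> ball c r" "p - v \<in> ball c r"
  shows "p + v \<in> K \<or> p - v \<in> K"
proof (rule ccontr)
  assume "\<not> ?thesis"
  moreover have "closed_segment (p - v) (p + v) \<subseteq> ball c r"
    using in_ball by (intro closed_segment_subset convex_ball)
  moreover have "steep ((p + v) - (p - v))"
    using steep_scaleR[OF steep, of 2] by (simp add: scaleR_2)
  moreover have "p = midpoint (p - v) (p + v)"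
    by (simp add: midpoint_def scaleR_2[symmetric])
  then have "p \<in> closed_segment (p - v) (p + v)" by (metis midpoint_in_closed_segment)
  ultimately have "p \<in> frontier K" using separated_point_in_frontier p_mem by blast
  then show False using p_mem K_disjoint_frontier by blast
qed

lemma steep_neighbour_mem:
  assumes steep: "steep v" and p_closure: "p \<in> closure K"
    and in_ball: "p \<in> ball c r" "p + v \<in> ball c r" "p - v \<in> ball c r"
  shows "p + v \<in> K \<or> p - v \<in> K"
proof (rule ccontr)
  assume not_K: "\<not> ?thesis"
  then have "p \<notin> K" using steep_neighbour_mem_open[OF steep _ in_ball] by blast
  then have "p \<in> frontier K \<inter> ball c r" using p_closure in_ball(1) by (simp add: closure_Un_frontier)
  then have "p + s *\<^sub>R v \<notin> frontier K" if "s = 1 \<or> s = -1" for s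
    using steep_line_frontier_unique[OF steep, of p s] that in_ball by auto
  from this[of 1] this[of "-1"] have "p + v \<in> - closure K" "p - v \<in> - closure K"
    using not_K by (auto simp: closure_Un_frontier)
  moreover define G where
    "G = {y. y \<in> ball c r \<and> y + v \<in> ball c r - closure K \<and> y - v \<in> ball c r - closure K}"
  ultimately have "p \<in> G" using in_ball by (simp add: G_def)
  have "G = ball c r \<inter> (\<lambda>y. y + v) -` (ball c r - closure K) \<inter> (\<lambda>y. y - v) -` (ball c r - closure K)"
    by (auto simp: G_def)
  then have "open G"
    by (simp only:) (intro open_Int open_vimage open_Diff open_ball closed_closure continuous_intros)
  then obtain y where "y \<in> K" "y \<in> G"
    using p_closure \<open>p \<in> G\<close> by (auto simp: closure_iff_nhds_not_empty)
  then show False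
    using steep_neighbour_mem_open[OF steep, of y] closure_subset[of K] by (auto simp: G_def)
qed

lemma span_steep: "span {v. steep v} = UNIV"
proof -
  have "open {v. steep v}"
    unfolding steep_def by (intro open_Collect_less continuous_intros)
  moreover have "steep w" by (simp add: steep_def norm_w)
  ultimately have "dim {v. steep v} = DIM('a)"
    using dim_openin[of UNIV "{v. steep v}"] by auto
  then show ?thesis by (simp add: dim_eq_full)
qed

end

section \<open>Sets on which derivatives are unique\<close>

definition line_directions :: "'a::real_normed_vector set \<Rightarrow> 'a \<Rightarrow> 'a set" where
  "line_directions S x = {v. \<forall>e>0. \<exists>d. 0 < \<bar>d\<bar> \<and> \<bar>d\<bar> < e \<and> x + d *\<^sub>R v \<in> S}"

definition tangentially_full :: "'a::real_normed_vector set \<Rightarrow> bool" where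
  "tangentially_full S \<longleftrightarrow> (\<forall>x\<in>S. span (line_directions S x) = UNIV)"

lemma has_derivative_imp_line_has_vector_derivative:
  fixes f :: "'a::real_normed_vector \<Rightarrow> 'b::real_normed_vector"
  assumes deriv: "(f has_derivative D) (at x within S)"
  shows "((\<lambda>d. f (x + d *\<^sub>R v)) has_vector_derivative D v) (at 0 within {d. x + d *\<^sub>R v \<in> S})"
proof -
  define T where "T = {d. x + d *\<^sub>R v \<in> S}"
  have line: "((\<lambda>d. x + d *\<^sub>R v) has_derivative (\<lambda>d. d *\<^sub>R v)) (at 0 within T)"
    by (auto intro!: derivative_eq_intros)
  have "(f has_derivative D) (at (x + 0 *\<^sub>R v) within (\<lambda>d. x + d *\<^sub>R v) ` T)"
    using deriv by (auto simp: T_def intro: has_derivative_subset)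
  from has_derivative_in_compose[OF line this] show ?thesis
    by (simp add: has_vector_derivative_def linear_scale[OF has_derivative_linear[OF deriv]] T_def)
qed

lemma has_derivative_unique_line_direction:
  fixes f :: "'a::real_normed_vector \<Rightarrow> 'b::real_normed_vector"
  assumes derivs: "(f has_derivative D1) (at x within S)" "(f has_derivative D2) (at x within S)"
    and direction: "v \<in> line_directions S x"
  shows "D1 v = D2 v"
proof -
  have "0 islimpt {d. x + d *\<^sub>R v \<in> S}"
    using direction unfolding islimpt_approachable line_directions_def by (simp add: conj_commute) metis
  then have "at 0 within {d. x + d *\<^sub>R v \<in> S} \<noteq> bot"
    using trivial_limit_within by blast
  then show ?thesis
    using derivs[THEN has_derivative_imp_line_has_vector_derivative, of v]
    by (rule vector_derivative_unique_within)
qed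

lemma tangentially_full_has_derivative_unique:
  assumes "tangentially_full S" "x \<in> S"
    and derivs: "(f has_derivative D1) (at x within S)" "(f has_derivative D2) (at x within S)"
  shows "D1 = D2"
proof
  fix v
  have "v \<in> span (line_directions S x)" using assms(1,2) by (simp add: tangentially_full_def)
  then show "D1 v = D2 v"
    using linear_eq_on_span[OF derivs[THEN has_derivative_linear]
      has_derivative_unique_line_direction[OF derivs]]
    by blast
qed

lemma frechet_derivative_tangentially_full:
  assumes "tangentially_full S" "x \<in> S" "(f has_derivative D) (at x within S)"
  shows "frechet_derivative f (at x within S) = D"
  using tangentially_full_has_derivative_unique[OF assms] assms(3) frechet_derivative_works
  by (metis differentiableI)

lemma eventually_line_mem_open:
  fixes x v :: "'a::real_normed_vector"
  assumes "open S" "x \<in> S"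
  shows "\<forall>\<^sub>F d in at_right 0. x + (s * d) *\<^sub>R v \<in> S"
  using assms by (intro topological_tendstoD) (auto intro!: tendsto_eq_intros)

lemma tangentially_full_open:
  assumes "open S"
  shows "tangentially_full S"
proof -
  have "v \<in> line_directions S x" if "x \<in> S" for x v
  proof -
    have "\<exists>d. 0 < \<bar>d\<bar> \<and> \<bar>d\<bar> < e \<and> x + d *\<^sub>R v \<in> S" if "e > 0" for e
    proof -
      have "\<forall>\<^sub>F d in at_right 0. d \<in> {0<..<e} \<and> x + (1 * d) *\<^sub>R v \<in> S"
        using assms \<open>x \<in> S\<close> \<open>e > 0\<close>
        by (intro eventually_conj eventually_line_mem_open eventually_at_right_real)
      from eventually_happens'[OF trivial_limit_at_right_real this]
      obtain d where "0 < d" "d < e" "x + d *\<^sub>R v \<in> S" by auto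
      then show ?thesis by (intro exI[of _ d]) simp
    qed
    then show ?thesis by (simp add: line_directions_def)
  qed
  then have "line_directions S x = UNIV" if "x \<in> S" for x using that by blast
  then show ?thesis by (simp add: tangentially_full_def)
qed

lemma (in transversal_ball) span_line_directions:
  assumes x_closure: "x \<in> closure K" "x \<in> ball c r" and K_subset: "K \<subseteq> S"
  shows "span (line_directions S x) = UNIV"
proof -
  have "v \<in> line_directions S x" if steep: "steep v" for v
  proof -
    have "\<exists>d. 0 < \<bar>d\<bar> \<and> \<bar>d\<bar> < e \<and> x + d *\<^sub>R v \<in> S" if "e > 0" for e
    proof -
      have "\<forall>\<^sub>F d in at_right 0. d \<in> {0<..<e} \<and>
          x + (1 * d) *\<^sub>R v \<in> ball c r \<and> x + (- 1 * d) *\<^sub>R v \<in> ball c r"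
        using x_closure(2) \<open>e > 0\<close>
        by (intro eventually_conj eventually_line_mem_open eventually_at_right_real open_ball)
      from eventually_happens'[OF trivial_limit_at_right_real this]
      obtain d where step: "0 < d" "d < e" "x + d *\<^sub>R v \<in> ball c r" "x - d *\<^sub>R v \<in> ball c r"
        by auto
      then have "x + d *\<^sub>R v \<in> K \<or> x - d *\<^sub>R v \<in> K"
        using x_closure steep by (intro steep_neighbour_mem steep_scaleR) auto
      then show ?thesis
      proof
        assume "x + d *\<^sub>R v \<in> K"
        then show ?thesis using K_subset step by (intro exI[of _ d]) auto
      next
        assume "x - d *\<^sub>R v \<in> K"
        then show ?thesis using K_subset step by (intro exI[of _ "- d"]) auto
      qed
    qed
    then show ?thesis by (simp add: line_directions_def)
  qed
  then have "span {v. steep v} \<subseteq> span (line_directions S x)" by (intro span_mono) auto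
  then show ?thesis using span_steep by blast
qed

section \<open>Lipschitz functions\<close>

lemma has_derivative_norm_le_of_lipschitz:
  fixes F :: "'a::real_normed_vector \<Rightarrow> 'b::real_normed_vector"
  assumes deriv: "(F has_derivative D) (at x)" and nbhd: "open T" "x \<in> T"
    and lip: "\<And>z. z \<in> T \<Longrightarrow> norm (F z - F x) \<le> C * norm (z - x)"
  shows "norm (D v) \<le> C * norm v"
proof -
  define q where "q h = norm (F (x + h *\<^sub>R v) - F x - h *\<^sub>R D v) / norm h" for h
  have "((\<lambda>h. F (x + h *\<^sub>R v)) has_vector_derivative D v) (at 0)"
    using has_derivative_imp_line_has_vector_derivative[OF deriv, of v] by simp
  then have "(q \<longlongrightarrow> 0) (at_right 0)"
    unfolding has_vector_derivative_def has_derivative_at q_def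
    by (auto elim: filterlim_mono[OF _ order_refl] simp: at_le)
  then have "((\<lambda>h. C * norm v + q h) \<longlongrightarrow> C * norm v + 0) (at_right 0)"
    by (intro tendsto_intros)
  moreover have "\<forall>\<^sub>F h in at_right 0. norm (D v) \<le> C * norm v + q h"
    using eventually_line_mem_open[OF nbhd, of 1 v] eventually_at_right_less[of 0]
  proof eventually_elim
    case (elim h)
    have "h * norm (D v) \<le> norm (F (x + h *\<^sub>R v) - F x) + norm (F (x + h *\<^sub>R v) - F x - h *\<^sub>R D v)"
      using norm_triangle_sub[of "h *\<^sub>R D v" "F (x + h *\<^sub>R v) - F x"] elim(2)
      by (simp add: norm_minus_commute)
    also have "\<dots> \<le> h * (C * norm v) + h * q h"
      using lip[of "x + h *\<^sub>R v"] elim by (simp add: q_def mult_ac)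
    finally show ?case using elim(2) by (simp flip: distrib_left)
  qed
  ultimately show ?thesis
    using tendsto_lowerbound trivial_limit_at_right_real by fastforce
qed

lemma continuous_le_on_dense:
  fixes h :: "'a::metric_space \<Rightarrow> real"
  assumes cont: "continuous_on A h" and dense: "S \<subseteq> A" "A \<subseteq> closure S"
    and bound: "\<And>x. x \<in> S \<Longrightarrow> h x \<le> b" and x_mem: "x \<in> A"
  shows "h x \<le> b"
proof -
  obtain s where approach: "\<And>n. s n \<in> S" "s \<longlonglongrightarrow> x"
    using x_mem dense(2) closure_sequential by blast
  then have "(\<lambda>n. h (s n)) \<longlonglongrightarrow> h x"
    using dense(1) by (intro continuous_on_tendsto_compose[OF cont _ x_mem] always_eventually) auto
  then show ?thesis
    using bound approach(1) by (auto intro: LIMSEQ_le_const2)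
qed

lemma lipschitz_on_dense:
  fixes f :: "'a::metric_space \<Rightarrow> 'b::metric_space"
  assumes lip: "L-lipschitz_on S f" and dense: "S \<subseteq> A" "A \<subseteq> closure S" and cont: "continuous_on A f"
  shows "L-lipschitz_on A f"
proof (rule lipschitz_onI)
  fix x y assume xy_mem: "x \<in> A" "y \<in> A"
  define h where "h z = dist (f (fst z)) (f (snd z)) - L * dist (fst z) (snd z)" for z
  have "h (x, y) \<le> 0"
  proof (rule continuous_le_on_dense[of "A \<times> A" h "S \<times> S"])
    show "continuous_on (A \<times> A) h" unfolding h_def
      by (intro continuous_intros continuous_on_compose2[OF cont]) auto
    show "A \<times> A \<subseteq> closure (S \<times> S)" using dense(2) by (auto simp: closure_Times)
    show "h z \<le> 0" if "z \<in> S \<times> S" for z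
      using lipschitz_onD[OF lip] that by (auto simp: h_def)
  qed (use dense(1) xy_mem in auto)
  then show "dist (f x) (f y) \<le> L * dist x y" by (simp add: h_def)
qed (use lip lipschitz_on_nonneg in blast)

lemma locally_lipschitz_on_compact_imp_lipschitz:
  fixes f :: "'a::metric_space \<Rightarrow> 'b::metric_space"
  assumes "compact X"
    and "\<And>x. x \<in> X \<Longrightarrow> \<exists>u>0. \<exists>L. L-lipschitz_on (cball x u \<inter> X) f"
  shows "\<exists>L. L-lipschitz_on X f"
proof -
  have "local_lipschitz {0::real} X (\<lambda>_. f)"
    using assms(2) by (intro local_lipschitzI) blast
  then show ?thesis
    using local_lipschitz_compact_implies_lipschitz[of "{0::real}" X "\<lambda>_. f"] assms(1)
    by (metis compact_sing continuous_on_const singletonI)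
qed

lemma lipschitz_on_imp_bounded_image:
  fixes f :: "'a::heine_borel \<Rightarrow> 'b::heine_borel"
  assumes "L-lipschitz_on S f" "bounded S"
  shows "bounded (f ` S)"
  using bounded_uniformly_continuous_image[OF lipschitz_on_uniformly_continuous[OF assms(1)] assms(2)] .

lemma lipschitz_on_scaleR:
  fixes f :: "'a::heine_borel \<Rightarrow> real" and g :: "'a \<Rightarrow> 'b::euclidean_space"
  assumes lip_f: "L-lipschitz_on S f" and lip_g: "M-lipschitz_on S g" and bounded_S: "bounded S"
  shows "\<exists>K. K-lipschitz_on S (\<lambda>x. f x *\<^sub>R g x)"
proof -
  obtain B where f_bound: "B > 0" "\<And>x. x \<in> S \<Longrightarrow> \<bar>f x\<bar> \<le> B"
    using lipschitz_on_imp_bounded_image[OF lip_f bounded_S] by (auto simp: bounded_pos)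
  obtain B' where g_bound: "B' > 0" "\<And>x. x \<in> S \<Longrightarrow> norm (g x) \<le> B'"
    using lipschitz_on_imp_bounded_image[OF lip_g bounded_S] by (auto simp: bounded_pos)
  note nonneg = lipschitz_on_nonneg[OF lip_f] lipschitz_on_nonneg[OF lip_g]
  have "dist (f x *\<^sub>R g x) (f y *\<^sub>R g y) \<le> (B * M + L * B') * dist x y" if xy_mem: "x \<in> S" "y \<in> S" for x y
  proof -
    have "f x *\<^sub>R g x - f y *\<^sub>R g y = f x *\<^sub>R (g x - g y) + (f x - f y) *\<^sub>R g y"
      by (simp add: algebra_simps)
    then have "dist (f x *\<^sub>R g x) (f y *\<^sub>R g y) \<le> \<bar>f x\<bar> * norm (g x - g y) + \<bar>f x - f y\<bar> * norm (g y)"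
      by (metis dist_norm norm_scaleR norm_triangle_ineq)
    also have "\<dots> \<le> B * (M * dist x y) + (L * dist x y) * B'"
      using lipschitz_onD[OF lip_f xy_mem] lipschitz_onD[OF lip_g xy_mem] f_bound g_bound xy_mem nonneg
      by (intro add_mono mult_mono) (auto simp: dist_norm)
    finally show ?thesis by (simp add: algebra_simps)
  qed
  then show ?thesis
    using f_bound(1) g_bound(1) nonneg by (intro exI[of _ "B * M + L * B'"] lipschitz_onI) auto
qed

section \<open>Lipschitz bounds up to the frontier\<close>

lemma norm_diff_le_segment_off_finite:
  fixes f :: "'a::real_normed_vector \<Rightarrow> 'b::banach"
  assumes cont: "continuous_on (closed_segment p q) f" and finite_S: "finite S" and C_nonneg: "0 \<le> C"
    and deriv: "\<And>y. y \<in> closed_segment p q - S \<Longrightarrow> (f has_derivative f' y) (at y)"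
    and bound: "\<And>y v. y \<in> closed_segment p q - S \<Longrightarrow> norm (f' y v) \<le> C * norm v"
  shows "norm (f q - f p) \<le> C * norm (q - p)"
proof (cases "p = q")
  case False
  define \<gamma> where "\<gamma> s = p + s *\<^sub>R (q - p)" for s :: real
  have line_in_segment: "\<gamma> s \<in> closed_segment p q" if "s \<in> {0..1}" for s
    using that by (auto simp: \<gamma>_def in_segment algebra_simps)
  have finite_preimage: "finite (\<gamma> -` S)"
    using finite_S False by (intro finite_vimageI) (auto simp: \<gamma>_def inj_on_def)
  have "((\<lambda>s. f' (\<gamma> s) (q - p)) has_integral (f (\<gamma> 1) - f (\<gamma> 0))) {0..1}"
  proof (rule fundamental_theorem_of_calculus_interior_strong[OF finite_preimage])
    fix s :: real assume "s \<in> {0<..<1} - \<gamma> -` S"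
    then have f's: "(f has_derivative f' (\<gamma> s)) (at (\<gamma> s))" using line_in_segment by (intro deriv) auto
    have "(\<gamma> has_derivative (\<lambda>h. h *\<^sub>R (q - p))) (at s)"
      unfolding \<gamma>_def by (auto intro!: derivative_eq_intros)
    from has_derivative_compose[OF this f's]
    show "((\<lambda>s. f (\<gamma> s)) has_vector_derivative f' (\<gamma> s) (q - p)) (at s)"
      by (simp add: has_vector_derivative_def linear_scale[OF has_derivative_linear[OF f's]])
  next
    show "continuous_on {0..1} (\<lambda>s. f (\<gamma> s))"
      by (rule continuous_on_compose2[OF cont])
        (use line_in_segment in \<open>auto simp: \<gamma>_def intro!: continuous_intros\<close>)
  qed simp
  then have "((\<lambda>s. f' (\<gamma> s) (q - p)) has_integral (f (\<gamma> 1) - f (\<gamma> 0))) (cbox 0 1)"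
    by simp
  from has_integral_bound_spike_finite[OF _ finite_preimage this, of "C * norm (q - p)"]
  have "norm (f (\<gamma> 1) - f (\<gamma> 0)) \<le> C * norm (q - p)"
    using C_nonneg line_in_segment bound by simp
  then show ?thesis by (simp add: \<gamma>_def)
qed simp

context transversal_ball
begin

context
  fixes f :: "'a \<Rightarrow> 'b::banach" and f' :: "'a \<Rightarrow> 'a \<Rightarrow> 'b" and C :: real
  assumes cont: "continuous_on (closure K \<inter> ball c r) f"
    and deriv: "\<And>y. y \<in> K \<inter> ball c r \<Longrightarrow> (f has_derivative f' y) (at y)"
    and bound: "\<And>y v. y \<in> K \<inter> ball c r \<Longrightarrow> norm (f' y v) \<le> C * norm v" and C_nonneg: "0 \<le> C"
begin

lemma steep_segment_norm_diff_le:
  assumes ends: "a \<in> K \<inter> ball c r" "b \<in> K \<inter> ball c r" and steep: "steep (b - a)"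
  shows "norm (f b - f a) \<le> C * norm (b - a)"
proof (rule norm_diff_le_segment_off_finite[OF _ _ C_nonneg])
  have ball: "closed_segment a b \<subseteq> ball c r"
    using ends by (intro closed_segment_subset convex_ball) auto
  then have sub: "closed_segment a b \<subseteq> closure K"
    using steep_segment_subset_closure[OF steep] ends by blast
  show "continuous_on (closed_segment a b) f"
    using cont ball sub by (auto intro: continuous_on_subset)
  show "finite (closed_segment a b \<inter> frontier K)"
  proof (cases "closed_segment a b \<inter> frontier K = {}")
    case False
    then obtain z where "z \<in> closed_segment a b \<inter> frontier K" by blast
    then have "closed_segment a b \<inter> frontier K \<subseteq> {z}"
      using steep_segment_frontier_unique[OF steep ball] by blast
    then show ?thesis by (rule finite_subset) simp
  qed simp
  fix y assume "y \<in> closed_segment a b - closed_segment a b \<inter> frontier K"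
  then have "y \<in> K \<inter> ball c r"
    using ball sub unfolding closure_Un_frontier by blast
  then show "(f has_derivative f' y) (at y)" "\<And>v. norm (f' y v) \<le> C * norm v"
    using deriv bound by auto
qed

text \<open>Two points at distance \<open>d\<close> are joined through \<open>p \<plusminus> 4 d w\<close>, with the sign chosen so that this
  point is in \<open>K\<close>; both legs are steep.\<close>

lemma lipschitz_on_tenth_ball: "(10 * C)-lipschitz_on (K \<inter> ball c (r / 10)) f"
proof (rule lipschitz_onI)
  fix p q assume p_near: "p \<in> K \<inter> ball c (r / 10)" and q_near: "q \<in> K \<inter> ball c (r / 10)"
  have "0 < r" using p_near zero_le_dist[of c p] unfolding Int_iff mem_ball by linarith
  then have pq_mem: "p \<in> K \<inter> ball c r" "q \<in> K \<inter> ball c r"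
    using p_near q_near subset_ball[of "r / 10" r c] by auto
  show "dist (f p) (f q) \<le> 10 * C * dist p q"
  proof (cases "p = q")
    case False
    define d where "d = norm (p - q)"
    have d_pos: "d > 0" using False by (simp add: d_def)
    have "d < r / 5"
      using p_near q_near dist_triangle_half_r[of c p "r / 5" q] by (simp add: d_def flip: dist_norm)
    then have in_ball: "p + s *\<^sub>R w \<in> ball c r" if "\<bar>s\<bar> \<le> 4 * d" for s
      using that p_near dist_triangle[of c "p + s *\<^sub>R w" p] norm_w by (auto simp: dist_norm)
    have "steep ((4 * d) *\<^sub>R w)" using d_pos norm_w by (simp add: steep_def)
    then have "p + (4 * d) *\<^sub>R w \<in> K \<or> p - (4 * d) *\<^sub>R w \<in> K"
      using p_near d_pos in_ball[of "4 * d"] in_ball[of "- (4 * d)"] in_ball[of 0]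
      by (intro steep_neighbour_mem_open) auto
    then obtain s where offset: "\<bar>s\<bar> = 4 * d" "p + s *\<^sub>R w \<in> K"
      using d_pos
      by (metis abs_minus_cancel abs_of_pos mult_pos_pos scaleR_minus_left uminus_add_conv_diff
        add.commute zero_less_numeral)
    define m where "m = p + s *\<^sub>R w"
    have m_mem: "m \<in> K \<inter> ball c r" using offset in_ball by (simp add: m_def)
    have leg: "norm (f m - f y) \<le> C * (5 * d)" if "y \<in> K \<inter> ball c r" "norm (p - y) \<le> d" for y
    proof -
      have "norm (f m - f y) \<le> C * norm (m - y)"
        using steep_offset(1)[OF that(2) d_pos offset(1)] that(1) m_mem
        by (intro steep_segment_norm_diff_le) (simp_all add: m_def)
      also have "\<dots> \<le> C * (5 * d)"
        using steep_offset(2)[OF that(2) d_pos offset(1)] C_nonneg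
        by (intro mult_left_mono) (simp_all add: m_def)
      finally show ?thesis .
    qed
    show ?thesis
      using leg[OF pq_mem(1)] leg[OF pq_mem(2)] d_pos dist_triangle3[of "f p" "f q" "f m"]
      by (simp add: d_def dist_norm)
  qed simp
qed (use C_nonneg in simp)

end

end

section \<open>Cones over spherical sets\<close>

lemma mem_scone_iff: "y \<in> scone A \<longleftrightarrow> y \<noteq> 0 \<and> sgn y \<in> A"
  by (simp add: scone_def sgn_div_norm)

lemma hext_eq_sgn: "hext f y = f (sgn y)"
  by (simp add: hext_def sgn_div_norm)

lemma sgn_unit: "norm x = 1 \<Longrightarrow> sgn x = x"
  by (simp add: sgn_div_norm)

lemma hext_unit: "norm x = 1 \<Longrightarrow> hext f x = f x"
  by (simp add: hext_eq_sgn sgn_unit)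

lemma scone_mono: "A \<subseteq> B \<Longrightarrow> scone A \<subseteq> scone B"
  by (auto simp: mem_scone_iff)

lemma subset_scone: "A \<subseteq> sphere 0 1 \<Longrightarrow> A \<subseteq> scone A"
  by (force simp: mem_scone_iff sgn_unit)

lemma scone_scaleR_iff: "c > 0 \<Longrightarrow> c *\<^sub>R y \<in> scone A \<longleftrightarrow> y \<in> scone A"
  by (simp add: mem_scone_iff sgn_scaleR)

lemma hext_scaleR: "c > 0 \<Longrightarrow> hext f (c *\<^sub>R y) = hext f y"
  by (simp add: hext_eq_sgn sgn_scaleR)

lemma open_scone:
  fixes A :: "'a::euclidean_space set"
  assumes "openin (top_of_set (sphere 0 1)) A"
  shows "open (scone A)"
proof -
  obtain T where trace: "open T" "A = sphere 0 1 \<inter> T"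
    using assms by (auto simp: openin_open)
  have "scone A = - {0} \<inter> sgn -` T"
    by (auto simp: mem_scone_iff trace(2) norm_sgn split: if_splits)
  moreover have "open (- {0} \<inter> sgn -` T)"
    using trace(1) by (intro continuous_open_preimage continuous_on_sgn) auto
  ultimately show ?thesis by simp
qed

lemma closure_scone:
  fixes A :: "'a::euclidean_space set"
  assumes "A \<subseteq> sphere 0 1"
  shows "closure (scone A) - {0} = scone (closure A)"
proof (intro equalityI subsetI)
  fix z assume z_mem: "z \<in> closure (scone A) - {0}"
  then obtain s where approach: "\<And>n. s n \<in> scone A" "s \<longlonglongrightarrow> z" using closure_sequential by blast
  have "(\<lambda>n. sgn (s n)) \<longlonglongrightarrow> sgn z" using approach(2) z_mem by (intro tendsto_sgn) auto
  moreover have "sgn (s n) \<in> A" for n using approach(1) by (simp add: mem_scone_iff)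
  ultimately show "z \<in> scone (closure A)"
    using z_mem unfolding mem_scone_iff closure_sequential
    by (intro conjI exI[of _ "\<lambda>n. sgn (s n)"]) auto
next
  fix z assume z_mem: "z \<in> scone (closure A)"
  then obtain s where approach: "\<And>n. s n \<in> A" "s \<longlonglongrightarrow> sgn z"
    by (auto simp: mem_scone_iff closure_sequential)
  have "z \<noteq> 0" using z_mem by (simp add: mem_scone_iff)
  then have "norm z *\<^sub>R s n \<in> scone A" for n
    using approach(1) subset_scone[OF assms] by (auto simp: scone_scaleR_iff)
  moreover have "(\<lambda>n. norm z *\<^sub>R s n) \<longlonglongrightarrow> norm z *\<^sub>R sgn z"
    using approach(2) by (intro tendsto_intros)
  ultimately have "norm z *\<^sub>R sgn z \<in> closure (scone A)"
    unfolding closure_sequential by (intro exI[of _ "\<lambda>n. norm z *\<^sub>R s n"]) auto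
  then show "z \<in> closure (scone A) - {0}"
    using \<open>z \<noteq> 0\<close> by (simp add: sgn_div_norm)
qed

lemma frontier_scone:
  fixes A :: "'a::euclidean_space set"
  assumes "A \<subseteq> sphere 0 1" "openin (top_of_set (sphere 0 1)) A"
  shows "frontier (scone A) - {0} = scone (closure A - A)"
proof -
  have "frontier (scone A) - {0} = (closure (scone A) - {0}) - scone A"
    using open_scone[OF assms(2)] by (auto simp: frontier_def interior_open)
  also have "\<dots> = scone (closure A - A)"
    unfolding closure_scone[OF assms(1)] by (auto simp: mem_scone_iff)
  finally show ?thesis .
qed

lemma norm_sgn_diff_le:
  fixes p q :: "'a::real_normed_vector"
  shows "norm p * norm (sgn p - sgn q) \<le> 2 * norm (p - q)"
proof (cases "q = 0")
  case False
  have "norm p *\<^sub>R (sgn p - sgn q) = (p - q) + (norm q - norm p) *\<^sub>R sgn q"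
    using False by (cases "p = 0") (simp_all add: sgn_div_norm algebra_simps)
  then have "norm p * norm (sgn p - sgn q) \<le> norm (p - q) + \<bar>norm q - norm p\<bar>"
    using norm_triangle_ineq[of "p - q" "(norm q - norm p) *\<^sub>R sgn q"] False
    by (metis norm_scaleR abs_norm_cancel norm_sgn mult.right_neutral)
  then show ?thesis
    using norm_triangle_ineq3[of q p] by (simp add: norm_minus_commute)
qed (simp add: norm_sgn)

lemma secant_slope_le_scone:
  fixes x :: "'a::euclidean_space"
  assumes x_nonzero: "x \<noteq> 0" and normal: "norm w = 1" "x \<bullet> w = 0"
    and slope_V: "secant_slope_le (1/8) w (V \<inter> ball (sgn x) d)" "d > 0"
  obtains r where "r > 0" "secant_slope_le (1/2) w (scone V \<inter> ball x r)"
proof -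
  have "isCont sgn x" using x_nonzero by (intro continuous_intros)
  moreover have "min d (1/4) > 0" using slope_V(2) by simp
  ultimately obtain r where sgn_near: "r > 0" "\<And>y. dist y x < r \<Longrightarrow> dist (sgn y) (sgn x) < min d (1/4)"
    unfolding continuous_at_eps_delta by blast
  have "\<bar>(p - q) \<bullet> w\<bar> \<le> 1/2 * norm (p - q)"
    if p_mem: "p \<in> scone V \<inter> ball x r" and q_mem: "q \<in> scone V \<inter> ball x r" for p q
  proof -
    have "sgn x \<bullet> w = 0" using normal(2) by (simp add: sgn_div_norm)
    then have "\<bar>sgn q \<bullet> w\<bar> \<le> norm (sgn q - sgn x)"
      using abs_inner_unit_le[OF normal(1), of "sgn q - sgn x"] by (simp add: inner_diff_left)
    then have slope_q: "\<bar>sgn q \<bullet> w\<bar> \<le> 1/4"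
      using sgn_near(2)[of q] q_mem by (simp add: dist_norm dist_commute norm_minus_commute)
    have "sgn p \<in> V \<inter> ball (sgn x) d" "sgn q \<in> V \<inter> ball (sgn x) d"
      using p_mem q_mem sgn_near(2)[of p] sgn_near(2)[of q] by (auto simp: mem_scone_iff dist_commute)
    then have slope_sgn: "\<bar>(sgn p - sgn q) \<bullet> w\<bar> \<le> 1/8 * norm (sgn p - sgn q)"
      using slope_V(1) secant_slope_leD by blast
    have "p - q = norm p *\<^sub>R (sgn p - sgn q) + (norm p - norm q) *\<^sub>R sgn q"
      using p_mem q_mem by (simp add: sgn_div_norm mem_scone_iff algebra_simps)
    then have "\<bar>(p - q) \<bullet> w\<bar> \<le> norm p * \<bar>(sgn p - sgn q) \<bullet> w\<bar> + \<bar>norm p - norm q\<bar> * \<bar>sgn q \<bullet> w\<bar>"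
      by (metis abs_triangle_ineq inner_add_left inner_scaleR_left abs_mult abs_norm_cancel)
    also have "\<dots> \<le> norm p * (1/8 * norm (sgn p - sgn q)) + norm (p - q) * (1/4)"
      using slope_sgn slope_q norm_triangle_ineq3[of p q] by (intro add_mono mult_mono) auto
    also have "\<dots> \<le> 1/2 * norm (p - q)" using norm_sgn_diff_le[of p q] by simp
    finally show ?thesis .
  qed
  then show ?thesis using that sgn_near(1) by (simp add: secant_slope_le_def)
qed

section \<open>Differential calculus on spherical sets\<close>

lemma hext_add_const: "hext (\<lambda>x. f x + t) = (\<lambda>y. hext f y + t)"
  by (simp add: fun_eq_iff hext_def)

lemma has_derivative_add_const_iff:
  "((\<lambda>y. f y + t) has_derivative D) F \<longleftrightarrow> (f has_derivative D) F"
  using has_derivative_add_const[of f D F t] has_derivative_add_const[of "\<lambda>y. f y + t" D F "- t"]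
  by auto

lemma frechet_derivative_hext_add_const:
  "frechet_derivative (hext (\<lambda>x. f x + t)) F = frechet_derivative (hext f) F"
  by (simp add: hext_add_const frechet_derivative_def has_derivative_add_const_iff)

lemma sgrad_add_const: "sgrad (\<lambda>x. f x + t) = sgrad f"
  by (simp add: fun_eq_iff sgrad_def frechet_derivative_hext_add_const)

lemma schouten_add_const: "schouten (\<lambda>x. f x + t) = schouten f"
  by (simp add: fun_eq_iff schouten_def shess_def sgrad_add_const frechet_derivative_hext_add_const)

lemma frechet_derivative_hext:
  assumes "hext f differentiable (at x within scone A)"
  shows "frechet_derivative (hext f) (at x within scone A) = (\<lambda>v. sgrad f A x \<bullet> v)"
proof
  fix v
  define D where "D = frechet_derivative (hext f) (at x within scone A)"
  have lin: "linear D"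
    using assms by (simp add: D_def linear_frechet_derivative)
  have "D v = D (\<Sum>b\<in>Basis. (v \<bullet> b) *\<^sub>R b)" by (simp add: euclidean_representation)
  also have "\<dots> = (\<Sum>b\<in>Basis. (v \<bullet> b) * D b)" by (simp add: linear_sum[OF lin] linear_cmul[OF lin])
  finally show "D v = sgrad f A x \<bullet> v"
    by (simp add: sgrad_def D_def inner_sum_left inner_commute[of v] mult.commute)
qed

lemma has_derivative_hext:
  assumes "hext f differentiable (at x within scone A)"
  shows "(hext f has_derivative (\<lambda>v. sgrad f A x \<bullet> v)) (at x within scone A)"
  using assms frechet_derivative_works by (metis frechet_derivative_hext)

lemma sgrad_eqI:
  assumes "tangentially_full (scone A)" "x \<in> scone A"
    and deriv: "(hext f has_derivative (\<lambda>v. a \<bullet> v)) (at x within scone A)"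
  shows "sgrad f A x = a"
  using tangentially_full_has_derivative_unique[OF assms
    has_derivative_hext[OF differentiableI[OF deriv]]]
  by (metis vector_eq_rdot)

lemma sgrad_tangent:
  assumes diff: "hext f differentiable (at x within scone A)" and x_mem: "x \<in> scone A"
  shows "sgrad f A x \<bullet> x = 0"
proof -
  define R where "R = {s *\<^sub>R x | s. s > 0}"
  have "R \<subseteq> scone A" using x_mem by (auto simp: R_def scone_scaleR_iff)
  then have grad: "(hext f has_derivative (\<lambda>v. sgrad f A x \<bullet> v)) (at x within R)"
    using has_derivative_hext[OF diff] has_derivative_subset by blast
  have "x \<in> R" by (auto simp: R_def intro: exI[of _ 1])
  moreover have "hext f z = hext f x" if "z \<in> R" for z
    using that by (auto simp: R_def hext_scaleR)
  ultimately have const: "(hext f has_derivative (\<lambda>v. 0)) (at x within R)"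
    by (rule has_derivative_transform[OF _ _ has_derivative_const])
  have "x \<in> line_directions R x"
    unfolding line_directions_def
  proof safe
    fix e :: real assume "e > 0"
    then show "\<exists>d. 0 < \<bar>d\<bar> \<and> \<bar>d\<bar> < e \<and> x + d *\<^sub>R x \<in> R"
      by (intro exI[of _ "e / 2"]) (auto simp: R_def scaleR_left_distrib intro!: exI[of _ "1 + e / 2"])
  qed
  then show ?thesis
    using has_derivative_unique_line_direction[OF grad const] by blast
qed

lemma has_derivative_hext_scaleR:
  assumes deriv: "(hext f has_derivative D) (at y within scone A)" and c_pos: "c > 0"
  shows "(hext f has_derivative (\<lambda>v. D (v /\<^sub>R c))) (at (c *\<^sub>R y) within scone A)"
proof -
  have "(hext f has_derivative D) (at ((c *\<^sub>R y) /\<^sub>R c) within (\<lambda>z. z /\<^sub>R c) ` scone A)"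
    using deriv c_pos by (auto simp: scone_scaleR_iff intro: has_derivative_subset)
  moreover have "((\<lambda>z. z /\<^sub>R c) has_derivative (\<lambda>v. v /\<^sub>R c)) (at (c *\<^sub>R y) within scone A)"
    by (auto intro!: derivative_eq_intros)
  ultimately have "((\<lambda>z. hext f (z /\<^sub>R c)) has_derivative (\<lambda>v. D (v /\<^sub>R c))) (at (c *\<^sub>R y) within scone A)"
    by (rule has_derivative_in_compose[rotated])
  then show ?thesis using c_pos by (simp add: hext_scaleR)
qed

definition sphere_differentiable_on :: "('a::euclidean_space \<Rightarrow> real) \<Rightarrow> 'a set \<Rightarrow> bool" where
  "sphere_differentiable_on f A \<longleftrightarrow> (\<forall>x\<in>A. hext f differentiable (at x within scone A))"

lemma has_derivative_hext_scone:
  assumes diff: "sphere_differentiable_on f A" and y_mem: "y \<in> scone A"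
  shows "(hext f has_derivative (\<lambda>v. (sgrad f A (sgn y) /\<^sub>R norm y) \<bullet> v)) (at y within scone A)"
proof -
  have "sgn y \<in> A" "norm y > 0" using y_mem by (auto simp: mem_scone_iff)
  then show ?thesis
    using has_derivative_hext_scaleR[OF has_derivative_hext, of f "sgn y" A "norm y"] diff
    by (simp add: sphere_differentiable_on_def sgn_div_norm)
qed

lemma hext_differentiable_scone:
  "sphere_differentiable_on f A \<Longrightarrow> y \<in> scone A \<Longrightarrow> hext f differentiable (at y within scone A)"
  using has_derivative_hext_scone differentiableI by blast

lemma sgrad_scone:
  assumes "tangentially_full (scone A)" "sphere_differentiable_on f A" "y \<in> scone A"
  shows "sgrad f A y = sgrad f A (sgn y) /\<^sub>R norm y"
  using assms by (intro sgrad_eqI has_derivative_hext_scone)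

lemma sgrad_subset:
  assumes "tangentially_full (scone B)" "B \<subseteq> A" "sphere_differentiable_on f A" "x \<in> scone B"
  shows "sgrad f B x = sgrad f A x"
  using assms scone_mono[OF assms(2)]
  by (intro sgrad_eqI has_derivative_subset[OF has_derivative_hext] hext_differentiable_scone) auto

lemma sphere_differentiable_on_subset:
  assumes "sphere_differentiable_on f A" "B \<subseteq> A"
  shows "sphere_differentiable_on f B"
  using assms scone_mono[OF assms(2)] differentiable_within_subset
  unfolding sphere_differentiable_on_def by blast

definition C2_on_sphere :: "('a::euclidean_space \<Rightarrow> real) \<Rightarrow> 'a set \<Rightarrow> bool" where
  "C2_on_sphere f A \<longleftrightarrow> sphere_differentiable_on f A \<and>
     (\<forall>x\<in>A. sgrad f A differentiable (at x within scone A)) \<and>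
     (\<forall>u v. continuous_on A (\<lambda>x. shess f A x u v))"

lemma has_derivative_sgrad_inner:
  assumes diff: "sphere_differentiable_on f A" and x_mem: "x \<in> scone A"
    and grad: "sgrad f A differentiable (at x within scone A)"
  shows "((\<lambda>y. sgrad f A y \<bullet> u) has_derivative shess f A x u) (at x within scone A)"
proof -
  have frechet_eq: "frechet_derivative (hext f) (at y within scone A) u = sgrad f A y \<bullet> u"
    if "y \<in> scone A" for y
    using frechet_derivative_hext[OF hext_differentiable_scone[OF diff that]] by simp
  obtain D where "(sgrad f A has_derivative D) (at x within scone A)"
    using grad by (auto simp: differentiable_def)
  from has_derivative_transform[OF x_mem frechet_eq has_derivative_inner_left[OF this]]
  have "((\<lambda>y. frechet_derivative (hext f) (at y within scone A) u) has_derivative shess f A x u)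
      (at x within scone A)"
    unfolding shess_def using differentiableI frechet_derivative_works by blast
  from has_derivative_transform[OF x_mem frechet_eq[symmetric] this] show ?thesis .
qed

lemma shess_eqI:
  assumes full: "tangentially_full (scone A)" and diff: "sphere_differentiable_on f A"
    and x_mem: "x \<in> scone A"
    and deriv: "((\<lambda>y. sgrad f A y \<bullet> u) has_derivative D) (at x within scone A)"
  shows "shess f A x u = D"
proof -
  have "((\<lambda>y. frechet_derivative (hext f) (at y within scone A) u)
      has_derivative D) (at x within scone A)"
    by (rule has_derivative_transform[OF x_mem _ deriv])
      (simp add: frechet_derivative_hext[OF hext_differentiable_scone[OF diff]])
  then show ?thesis
    unfolding shess_def using frechet_derivative_tangentially_full[OF full x_mem] by fast
qed

lemma hext_exp: "hext (\<lambda>x. exp (c * f x)) = (\<lambda>y. exp (c * hext f y))"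
  by (simp add: fun_eq_iff hext_def)

lemma has_derivative_hext_exp:
  assumes "hext f differentiable (at y within scone A)"
  shows "(hext (\<lambda>x. exp (c * f x)) has_derivative (\<lambda>v. ((c * exp (c * hext f y)) *\<^sub>R sgrad f A y) \<bullet> v))
    (at y within scone A)"
  unfolding hext_exp using has_derivative_hext[OF assms]
  by (auto intro!: derivative_eq_intros simp: mult_ac)

lemma sphere_differentiable_on_exp:
  "sphere_differentiable_on f A \<Longrightarrow> sphere_differentiable_on (\<lambda>x. exp (c * f x)) A"
  using has_derivative_hext_exp differentiableI unfolding sphere_differentiable_on_def by blast

lemma sgrad_exp:
  assumes "tangentially_full (scone A)" "sphere_differentiable_on f A" "y \<in> scone A"
  shows "sgrad (\<lambda>x. exp (c * f x)) A y = (c * exp (c * hext f y)) *\<^sub>R sgrad f A y"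
  using assms by (intro sgrad_eqI has_derivative_hext_exp hext_differentiable_scone)

lemma has_derivative_sgrad_exp:
  assumes full: "tangentially_full (scone A)" and diff: "sphere_differentiable_on f A"
    and x_mem: "x \<in> scone A"
    and hess: "((\<lambda>y. sgrad f A y \<bullet> u) has_derivative H) (at x within scone A)"
  shows "((\<lambda>y. sgrad (\<lambda>x. exp (c * f x)) A y \<bullet> u) has_derivative
      (\<lambda>v. exp (c * hext f x) * (c\<^sup>2 * (sgrad f A x \<bullet> u) * (sgrad f A x \<bullet> v) + c * H v)))
    (at x within scone A)"
proof (rule has_derivative_transform[OF x_mem])
  show "sgrad (\<lambda>x. exp (c * f x)) A y \<bullet> u = c * exp (c * hext f y) * (sgrad f A y \<bullet> u)"
    if "y \<in> scone A" for y
    using sgrad_exp[OF full diff that] by simp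
  define P where "P y = sgrad f A y \<bullet> u" for y
  have "(P has_derivative H) (at x within scone A)"
    using hess by (simp add: P_def[abs_def])
  then show "((\<lambda>y. c * exp (c * hext f y) * (sgrad f A y \<bullet> u)) has_derivative
      (\<lambda>v. exp (c * hext f x) * (c\<^sup>2 * (sgrad f A x \<bullet> u) * (sgrad f A x \<bullet> v) + c * H v)))
    (at x within scone A)"
    unfolding P_def[symmetric] using has_derivative_hext[OF hext_differentiable_scone[OF diff x_mem]]
    by (auto intro!: derivative_eq_intros simp: algebra_simps power2_eq_square)
qed

lemma has_derivative_at_within_transform_ball:
  assumes deriv: "(g has_derivative D) (at y)" and y_mem: "y \<in> ball x r \<inter> S"
    and agree: "\<And>z. z \<in> ball x r \<inter> S \<Longrightarrow> g z = f z"
  shows "(f has_derivative D) (at y within S)"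
proof -
  obtain d where sub_ball: "d > 0" "ball y d \<subseteq> ball x r"
    using y_mem by (metis IntD1 open_ball open_contains_ball)
  show ?thesis
  proof (rule has_derivative_transform_within[OF has_derivative_at_withinI[OF deriv] sub_ball(1)])
    show "g z = f z" if "z \<in> S" "dist z y < d" for z
      using that sub_ball(2) by (intro agree) (auto simp: dist_commute)
  qed (use y_mem in simp)
qed

lemma c2alpha_on_local_derivatives:
  assumes C2alpha: "c2alpha_on \<alpha> A f" and alpha_pos: "0 < \<alpha>" and x_mem: "x \<in> A"
  obtains r g1 g2 where "r > 0"
    "\<And>y. y \<in> ball x r \<inter> scone A \<Longrightarrow> (hext f has_derivative g1 y) (at y within scone A)"
    "\<And>y u. y \<in> ball x r \<Longrightarrow> ((\<lambda>z. g1 z u) has_derivative g2 y u) (at y)"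
    "\<And>u v. isCont (\<lambda>y. g2 y u v) x"
proof -
  obtain r g g1 g2 C where r_pos: "r > 0"
    and deriv: "\<forall>y\<in>ball x r. (g has_derivative g1 y) (at y)"
    and deriv2: "\<forall>y\<in>ball x r. \<forall>u. ((\<lambda>z. g1 z u) has_derivative g2 y u) (at y)"
    and hoelder: "\<forall>y\<in>ball x r. \<forall>z\<in>ball x r. \<forall>u v.
        \<bar>g2 y u v - g2 z u v\<bar> \<le> C * norm u * norm v * dist y z powr \<alpha>"
    and agree: "\<forall>y\<in>ball x r \<inter> scone A. g y = hext f y"
    using C2alpha x_mem unfolding c2alpha_on_def by blast
  have "(hext f has_derivative g1 y) (at y within scone A)" if "y \<in> ball x r \<inter> scone A" for y
    using that deriv agree
    by (intro has_derivative_at_within_transform_ball[where g = g, OF _ that]) auto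
  moreover have "isCont (\<lambda>y. g2 y u v) x" for u v
  proof -
    have "((\<lambda>y. g2 y u v - g2 x u v) \<longlongrightarrow> 0) (at x)"
    proof (rule Lim_null_comparison)
      show "\<forall>\<^sub>F y in at x. norm (g2 y u v - g2 x u v) \<le> C * norm u * norm v * dist y x powr \<alpha>"
        using hoelder r_pos by (intro eventually_at_in_open'[of "ball x r", THEN eventually_mono]) auto
      have "((\<lambda>y. dist y x) \<longlongrightarrow> 0) (at x)" by (intro tendsto_eq_intros) auto
      then have "((\<lambda>y. dist y x powr \<alpha>) \<longlongrightarrow> 0) (at x)"
        using alpha_pos by (intro tendsto_zero_powrI[where b = \<alpha>]) auto
      then show "((\<lambda>y. C * norm u * norm v * dist y x powr \<alpha>) \<longlongrightarrow> 0) (at x)"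
        by (rule tendsto_mult_right_zero)
    qed
    then show ?thesis unfolding isCont_def by (rule LIM_zero_cancel)
  qed
  ultimately show ?thesis using that r_pos deriv2 by blast
qed

lemma c2alpha_on_imp_sphere_differentiable_on:
  assumes unit: "A \<subseteq> sphere 0 1" and C2alpha: "c2alpha_on \<alpha> A f" and alpha_pos: "0 < \<alpha>"
  shows "sphere_differentiable_on f A"
  unfolding sphere_differentiable_on_def
proof
  fix x assume x_mem: "x \<in> A"
  obtain r g1 where
    "r > 0" "\<And>y. y \<in> ball x r \<inter> scone A \<Longrightarrow> (hext f has_derivative g1 y) (at y within scone A)"
    using c2alpha_on_local_derivatives[OF C2alpha alpha_pos x_mem] by metis
  moreover have "x \<in> ball x r \<inter> scone A" using \<open>r > 0\<close> x_mem subset_scone[OF unit] by auto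
  ultimately show "hext f differentiable (at x within scone A)"
    using differentiableI by blast
qed

lemma c2alpha_on_local_sgrad_derivative:
  assumes full: "tangentially_full (scone A)" and C2alpha: "c2alpha_on \<alpha> A f" and alpha_pos: "0 < \<alpha>"
    and x_mem: "x \<in> A"
  obtains r g2 where "r > 0"
    "\<And>y u. y \<in> ball x r \<inter> scone A \<Longrightarrow> ((\<lambda>z. sgrad f A z \<bullet> u) has_derivative g2 y u) (at y within scone A)"
    "\<And>u v. isCont (\<lambda>y. g2 y u v) x"
proof -
  obtain r g1 g2 where r_pos: "r > 0"
    and deriv: "\<And>y. y \<in> ball x r \<inter> scone A \<Longrightarrow> (hext f has_derivative g1 y) (at y within scone A)"
    and deriv2: "\<And>y u. y \<in> ball x r \<Longrightarrow> ((\<lambda>z. g1 z u) has_derivative g2 y u) (at y)"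
    and cont: "\<And>u v. isCont (\<lambda>y. g2 y u v) x"
    using c2alpha_on_local_derivatives[OF C2alpha alpha_pos x_mem] by metis
  have grad: "sgrad f A y \<bullet> u = g1 y u" if "y \<in> ball x r \<inter> scone A" for y u
    using tangentially_full_has_derivative_unique[OF full _ deriv
      has_derivative_hext[OF differentiableI[OF deriv]]] that
    by (metis IntD2)
  have "((\<lambda>z. sgrad f A z \<bullet> u) has_derivative g2 y u) (at y within scone A)"
    if y_mem: "y \<in> ball x r \<inter> scone A" for y u
    using y_mem deriv2 grad
    by (intro has_derivative_at_within_transform_ball[where g = "\<lambda>z. g1 z u", OF _ y_mem]) auto
  then show ?thesis using that r_pos cont by blast
qed

lemma c2alpha_on_imp_C2_on_sphere:
  fixes f :: "'a::euclidean_space \<Rightarrow> real"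
  assumes full: "tangentially_full (scone A)" and unit: "A \<subseteq> sphere 0 1"
    and C2alpha: "c2alpha_on \<alpha> A f" and alpha_pos: "0 < \<alpha>"
  shows "C2_on_sphere f A"
proof -
  have diff: "sphere_differentiable_on f A"
    using unit C2alpha alpha_pos by (rule c2alpha_on_imp_sphere_differentiable_on)
  moreover have "sgrad f A differentiable (at x within scone A) \<and>
      continuous (at x within A) (\<lambda>y. shess f A y u v)" if x_mem: "x \<in> A" for x u v
  proof -
    obtain r g2 where r_pos: "r > 0"
      and grad_deriv: "\<And>y u. y \<in> ball x r \<inter> scone A \<Longrightarrow>
        ((\<lambda>z. sgrad f A z \<bullet> u) has_derivative g2 y u) (at y within scone A)"
      and cont: "\<And>u v. isCont (\<lambda>y. g2 y u v) x"
      using c2alpha_on_local_sgrad_derivative[OF full C2alpha alpha_pos x_mem] by metis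
    have "x \<in> ball x r \<inter> scone A" using r_pos x_mem subset_scone[OF unit] by auto
    then have "sgrad f A differentiable (at x within scone A)"
      using grad_deriv differentiableI by (subst differentiable_componentwise_within) blast
    moreover have "shess f A y u = g2 y u" if "y \<in> ball x r \<inter> scone A" for y
      using that by (intro shess_eqI[OF full diff] grad_deriv) auto
    then have "continuous (at x within A) (\<lambda>y. shess f A y u v)"
      using subset_scone[OF unit]
      by (intro continuous_transform_within[OF
          continuous_at_imp_continuous_at_within[OF cont] r_pos x_mem])
        (auto simp: dist_commute)
    ultimately show ?thesis by blast
  qed
  ultimately show ?thesis
    by (simp add: C2_on_sphere_def continuous_on_eq_continuous_within)
qed

lemma C2_on_sphere_imp_continuous_on_sgrad:
  assumes "C2_on_sphere f A" "A \<subseteq> sphere 0 1"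
  shows "continuous_on A (sgrad f A)"
  using assms(1) unfolding C2_on_sphere_def continuous_on_eq_continuous_within
  by (blast intro:
    continuous_within_subset[OF differentiable_imp_continuous_within subset_scone[OF assms(2)]])

lemma sphere_differentiable_on_imp_continuous_on:
  assumes "sphere_differentiable_on f A" "A \<subseteq> sphere 0 1"
  shows "continuous_on A f"
proof -
  have "continuous_on A (hext f)"
    using assms(1) unfolding sphere_differentiable_on_def continuous_on_eq_continuous_within
    by (blast intro:
      continuous_within_subset[OF differentiable_imp_continuous_within subset_scone[OF assms(2)]])
  moreover have "hext f x = f x" if "x \<in> A" for x
    using assms(2) that by (intro hext_unit) auto
  ultimately show ?thesis by (simp cong: continuous_on_cong)
qed

section \<open>Spherical domains bounded by submanifolds\<close>

lemma frontier_submanifold_slope: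
  fixes V \<Omega> :: "'a::euclidean_space set"
  assumes submanifold: "compact_submanifold_of_sphere V" "x \<in> V"
    and domain: "\<Omega> \<subseteq> sphere 0 1" "x \<in> closure \<Omega>" "V \<inter> \<Omega> = {}" and c_pos: "c > 0"
  obtains w d where "norm w = 1" "x \<bullet> w = 0" "d > 0" "secant_slope_le c w (V \<inter> ball x d)"
proof -
  have sphere: "V \<subseteq> sphere 0 1" and "emb_submanifold V"
    using submanifold(1) by (auto simp: compact_submanifold_of_sphere_def)
  then obtain U \<psi> L where "flat_chart V U \<psi> L" and x_chart: "x \<in> U"
    using emb_submanifold_chart submanifold(2) by blast
  interpret flat_chart V U \<psi> L by fact
  have "dim L + 2 \<le> DIM('a)"
  proof (rule ccontr)
    assume "\<not> ?thesis"
    then have "openin (top_of_set (sphere 0 1)) (U \<inter> V)"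
      using sphere by (intro codim_1_openin_sphere) auto
    then obtain N where trace: "open N" "U \<inter> V = sphere 0 1 \<inter> N"
      by (auto simp: openin_open)
    then have "x \<in> N" using x_chart submanifold(2) by blast
    then have "\<Omega> \<inter> N \<noteq> {}"
      using domain(2) trace(1) by (auto simp: closure_iff_nhds_not_empty)
    then show False using trace(2) domain(1,3) by blast
  qed
  moreover obtain T where secant_space: "subspace T" "dim T \<le> dim L" "approximates_secants T V x"
    using approximates_secants_exists[OF x_chart] .
  moreover have "dim (insert x T) \<le> dim T + 1" by (simp add: dim_insert)
  ultimately have "dim (insert x T) < DIM('a)" by linarith
  then obtain v where normal: "v \<noteq> 0" "\<And>y. y \<in> span (insert x T) \<Longrightarrow> orthogonal v y"
    using orthogonal_to_subspace_exists by blast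
  have orth: "y \<bullet> sgn v = 0" if "y \<in> insert x T" for y
    using normal(2)[OF span_base[OF that]] by (simp add: sgn_div_norm orthogonal_def inner_commute)
  have "norm (sgn v) = 1" using normal(1) by (simp add: norm_sgn)
  then obtain d where "d > 0" "secant_slope_le c (sgn v) (V \<inter> ball x d)"
    using approximates_secants_slope_le[OF secant_space(3) _ _ c_pos] orth by blast
  then show ?thesis
    using that[of "sgn v" d] orth \<open>norm (sgn v) = 1\<close> by simp
qed

lemma transversal_ball_mono:
  assumes "transversal_ball K w x r" "s \<le> r"
  shows "transversal_ball K w x s"
  using assms subset_ball[OF assms(2), of x] unfolding transversal_ball_def
  by (blast intro: secant_slope_le_subset)

locale sphere_domain =
  fixes \<Omega> V1 V2 :: "'a::euclidean_space set"
  assumes subset_sphere: "\<Omega> \<subseteq> sphere 0 1"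
    and open_in_sphere: "openin (top_of_set (sphere 0 1)) \<Omega>"
    and boundary: "closure \<Omega> - \<Omega> = V1 \<union> V2" and disjoint: "V1 \<inter> V2 = {}"
    and V1: "compact_submanifold_of_sphere V1" and V2: "compact_submanifold_of_sphere V2"
begin

lemma closure_subset_sphere: "closure \<Omega> \<subseteq> sphere 0 1"
  using subset_sphere by (rule closure_minimal) simp

lemma compact_closure: "compact (closure \<Omega>)"
  using closure_subset_sphere bounded_subset[OF bounded_sphere] by (simp add: compact_eq_bounded_closed)

lemma open_scone_domain: "open (scone \<Omega>)"
  using open_in_sphere by (rule open_scone)

lemma sphere_domain_commute: "sphere_domain \<Omega> V2 V1"
  using subset_sphere open_in_sphere boundary disjoint V1 V2
  by unfold_locales (auto simp: Un_commute Int_commute)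

lemma transversal_ball_at_V1:
  assumes x_V1: "x \<noteq> 0" "sgn x \<in> V1"
  shows "\<exists>w r. r > 0 \<and> transversal_ball (scone \<Omega>) w x r"
proof -
  have "sgn x \<in> closure \<Omega>" "V1 \<inter> \<Omega> = {}" using x_V1(2) boundary by auto
  then obtain w d where
    normal: "norm w = 1" "sgn x \<bullet> w = 0" "d > 0" "secant_slope_le (1/8) w (V1 \<inter> ball (sgn x) d)"
    using frontier_submanifold_slope[OF V1 x_V1(2) subset_sphere, of "1/8"] by auto
  have "open (- V2)"
    using V2 by (simp add: compact_submanifold_of_sphere_def compact_imp_closed open_Compl)
  then obtain e where away: "e > 0" "ball (sgn x) e \<subseteq> - V2"
    using x_V1(2) disjoint open_contains_ball by (metis ComplI disjoint_iff)
  have "(closure \<Omega> - \<Omega>) \<inter> ball (sgn x) (min d e) \<subseteq> V1 \<inter> ball (sgn x) d"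
    using away(2) boundary by auto
  then have slope: "secant_slope_le (1/8) w ((closure \<Omega> - \<Omega>) \<inter> ball (sgn x) (min d e))"
    using normal(4) by (rule secant_slope_le_subset[rotated])
  have "x \<bullet> w = 0" "min d e > 0" using normal(2,3) away(1) x_V1(1) by (simp_all add: sgn_div_norm)
  then obtain r where cone_slope: "r > 0" "secant_slope_le (1/2) w (scone (closure \<Omega> - \<Omega>) \<inter> ball x r)"
    by (rule secant_slope_le_scone[OF x_V1(1) normal(1) _ slope])
  have "ball x (min r (norm x)) \<subseteq> ball x r - {0}" by auto
  then have "frontier (scone \<Omega>) \<inter> ball x (min r (norm x)) \<subseteq> scone (closure \<Omega> - \<Omega>) \<inter> ball x r"
    using frontier_scone[OF subset_sphere open_in_sphere] by blast
  then have "transversal_ball (scone \<Omega>) w x (min r (norm x))"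
    using open_scone_domain normal(1) secant_slope_le_subset[OF cone_slope(2)] by unfold_locales
  then show ?thesis using cone_slope(1) x_V1(1) by (metis min_less_iff_conj zero_less_norm_iff)
qed

lemma transversal_ball_exists:
  assumes x_nonzero: "x \<noteq> 0"
  obtains w r where "r > 0" "r \<le> norm x / 2" "transversal_ball (scone \<Omega>) w x r"
proof -
  have "\<exists>w r. r > 0 \<and> transversal_ball (scone \<Omega>) w x r"
  proof (cases "x \<in> frontier (scone \<Omega>)")
    case True
    then have "x \<in> scone (closure \<Omega> - \<Omega>)"
      using x_nonzero frontier_scone[OF subset_sphere open_in_sphere] by blast
    then have "sgn x \<in> V1 \<or> sgn x \<in> V2" by (simp add: boundary mem_scone_iff)
    then show ?thesis
      using transversal_ball_at_V1[OF x_nonzero]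
        sphere_domain.transversal_ball_at_V1[OF sphere_domain_commute x_nonzero] by blast
  next
    case False
    moreover have "open (- frontier (scone \<Omega>))" by (simp add: open_Compl)
    ultimately obtain r where ball_r: "r > 0" "ball x r \<subseteq> - frontier (scone \<Omega>)"
      using open_contains_ball by blast
    then have "frontier (scone \<Omega>) \<inter> ball x r = {}" by blast
    then have "transversal_ball (scone \<Omega>) (sgn x) x r"
      using open_scone_domain x_nonzero by unfold_locales (auto simp: secant_slope_le_def norm_sgn)
    then show ?thesis using ball_r(1) by blast
  qed
  then obtain w r where ball_r: "r > 0" "transversal_ball (scone \<Omega>) w x r" by blast
  then have "transversal_ball (scone \<Omega>) w x (min r (norm x / 2))"
    by (intro transversal_ball_mono[OF ball_r(2)]) simp
  then show ?thesis using that[of "min r (norm x / 2)" w] x_nonzero ball_r(1) by simp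
qed

lemma tangentially_full_scone:
  assumes between: "\<Omega> \<subseteq> A" "A \<subseteq> closure \<Omega>"
  shows "tangentially_full (scone A)"
  unfolding tangentially_full_def
proof
  fix x assume "x \<in> scone A"
  then have x_closure: "x \<noteq> 0" "x \<in> closure (scone \<Omega>)"
    using scone_mono[OF between(2)] unfolding closure_scone[OF subset_sphere, symmetric] by auto
  obtain w r where "r > 0" and ball: "transversal_ball (scone \<Omega>) w x r"
    using transversal_ball_exists[OF x_closure(1)] .
  then show "span (line_directions (scone A) x) = UNIV"
    using transversal_ball.span_line_directions[OF ball x_closure(2) _ scone_mono[OF between(1)]]
    by simp
qed

lemma hext_lipschitz_near_closure_point:
  assumes diff: "sphere_differentiable_on f \<Omega>"
    and extension: "continuous_on (closure \<Omega>) F" "\<And>x. x \<in> \<Omega> \<Longrightarrow> F x = f x"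
    and grad_bound: "\<And>x. x \<in> \<Omega> \<Longrightarrow> norm (sgrad f \<Omega> x) \<le> B" "0 \<le> B" and x_unit: "norm x = 1"
  obtains r where "r > 0" "(20 * B)-lipschitz_on (scone \<Omega> \<inter> ball x r) (hext F)"
proof -
  obtain w r where r_small: "r > 0" "r \<le> 1/2" and "transversal_ball (scone \<Omega>) w x r"
    using transversal_ball_exists[of x] x_unit by (metis norm_zero zero_neq_one)
  then interpret transversal_ball "scone \<Omega>" w x r by blast
  have far: "norm y \<ge> 1/2" if "y \<in> ball x r" for y
    using that r_small(2) norm_triangle_sub[of x y] x_unit by (simp add: dist_norm)
  have "(10 * (2 * B))-lipschitz_on (scone \<Omega> \<inter> ball x (r / 10)) (hext F)"
  proof (rule lipschitz_on_tenth_ball[where f' = "\<lambda>y v. (sgrad f \<Omega> (sgn y) /\<^sub>R norm y) \<bullet> v"])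
    have "0 \<notin> ball x r" using far[of 0] by auto
    then have "closure (scone \<Omega>) \<inter> ball x r \<subseteq> scone (closure \<Omega>)"
      using closure_scone[OF subset_sphere] by blast
    moreover have "continuous_on (scone (closure \<Omega>)) (hext F)"
      unfolding hext_def
      by (rule continuous_on_compose2[OF extension(1)]) (auto simp: scone_def intro!: continuous_intros)
    ultimately show "continuous_on (closure (scone \<Omega>) \<inter> ball x r) (hext F)"
      using continuous_on_subset by blast
    fix y assume y_mem: "y \<in> scone \<Omega> \<inter> ball x r"
    then have "(hext f has_derivative (\<lambda>v. (sgrad f \<Omega> (sgn y) /\<^sub>R norm y) \<bullet> v)) (at y)"
      using has_derivative_hext_scone[OF diff] open_scone_domain by (metis IntD1 at_within_open)
    then show "(hext F has_derivative (\<lambda>v. (sgrad f \<Omega> (sgn y) /\<^sub>R norm y) \<bullet> v)) (at y)"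
      by (rule has_derivative_transform_within_open[OF _ open_scone_domain])
         (use y_mem in \<open>auto simp: hext_eq_sgn mem_scone_iff extension(2)\<close>)
    have "sgn y \<in> \<Omega>" "1 / norm y \<le> 2" using y_mem far[of y] by (auto simp: mem_scone_iff field_simps)
    then have "norm (sgrad f \<Omega> (sgn y) /\<^sub>R norm y) \<le> 2 * B"
      using mult_mono[of "1 / norm y" 2 "norm (sgrad f \<Omega> (sgn y))" B] grad_bound
      by (simp add: divide_simps)
    then show "norm ((sgrad f \<Omega> (sgn y) /\<^sub>R norm y) \<bullet> v) \<le> 2 * B * norm v" for v
      unfolding real_norm_def by (meson Cauchy_Schwarz_ineq2 mult_right_mono norm_ge_zero order_trans)
  qed (use grad_bound(2) in simp)
  then show ?thesis using that[of "r / 10"] r_small(1) by simp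
qed

lemma lipschitz_near_closure_point:
  assumes diff: "sphere_differentiable_on f \<Omega>"
    and extension: "continuous_on (closure \<Omega>) F" "\<And>x. x \<in> \<Omega> \<Longrightarrow> F x = f x"
    and grad_bound: "\<And>x. x \<in> \<Omega> \<Longrightarrow> norm (sgrad f \<Omega> x) \<le> B" "0 \<le> B" and x_mem: "x \<in> closure \<Omega>"
  shows "\<exists>u>0. \<exists>L. L-lipschitz_on (cball x u \<inter> closure \<Omega>) F"
proof -
  have "norm x = 1" using x_mem closure_subset_sphere by auto
  then obtain r where r_pos: "r > 0" and lip: "(20 * B)-lipschitz_on (scone \<Omega> \<inter> ball x r) (hext F)"
    using hext_lipschitz_near_closure_point[OF diff extension grad_bound] by blast
  have "(20 * B)-lipschitz_on (\<Omega> \<inter> ball x r) F"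
  proof (rule lipschitz_on_transform[OF lipschitz_on_subset[OF lip]])
    show "F y = hext F y" if "y \<in> \<Omega> \<inter> ball x r" for y
      using that subset_sphere by (subst hext_unit) auto
  qed (use subset_scone[OF subset_sphere] in auto)
  then have "(20 * B)-lipschitz_on (closure \<Omega> \<inter> ball x r) F"
  proof (rule lipschitz_on_dense)
    show "closure \<Omega> \<inter> ball x r \<subseteq> closure (\<Omega> \<inter> ball x r)"
      using open_Int_closure_subset[of "ball x r" \<Omega>] by (simp add: Int_commute)
    show "continuous_on (closure \<Omega> \<inter> ball x r) F"
      using extension(1) by (rule continuous_on_subset) simp
  qed (use closure_subset[of \<Omega>] in auto)
  then have "(20 * B)-lipschitz_on (cball x (r / 2) \<inter> closure \<Omega>) F"
    by (rule lipschitz_on_subset) (use r_pos in auto)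
  then show ?thesis using r_pos by (intro exI[of _ "r / 2"]) auto
qed

lemma c11_closure_imp_lipschitz:
  assumes diff: "sphere_differentiable_on f \<Omega>" and c11: "c11_closure \<Omega> f"
  shows "\<exists>L. L-lipschitz_on \<Omega> f"
proof -
  obtain F where extension: "continuous_on (closure \<Omega>) F" "\<And>x. x \<in> \<Omega> \<Longrightarrow> F x = f x"
    using c11 unfolding c11_closure_def by blast
  obtain L where "L-lipschitz_on \<Omega> (sgrad f \<Omega>)"
    using c11 unfolding c11_closure_def by blast
  from lipschitz_on_imp_bounded_image[OF this bounded_subset[OF bounded_sphere subset_sphere]]
  obtain B where grad_bound: "B > 0" "\<And>x. x \<in> \<Omega> \<Longrightarrow> norm (sgrad f \<Omega> x) \<le> B"
    by (auto simp: bounded_pos)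
  have "\<exists>u>0. \<exists>L. L-lipschitz_on (cball x u \<inter> closure \<Omega>) F" if "x \<in> closure \<Omega>" for x
    using lipschitz_near_closure_point[OF diff extension grad_bound(2) _ that] grad_bound(1) by simp
  then obtain M where "M-lipschitz_on (closure \<Omega>) F"
    using locally_lipschitz_on_compact_imp_lipschitz[OF compact_closure] by blast
  then have "M-lipschitz_on \<Omega> F" using closure_subset by (rule lipschitz_on_subset)
  then show ?thesis using extension(2) by (metis lipschitz_on_transform)
qed

end

text \<open>The gradient of the homogeneous extension is homogeneous of degree \<open>- 1\<close>, so off the sphere its
  Lipschitz constant also involves its size.\<close>

lemma norm_sgrad_diff_le:
  assumes full: "tangentially_full (scone A)" and unit: "A \<subseteq> sphere 0 1"
    and diff: "sphere_differentiable_on f A"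
    and lip: "L-lipschitz_on A (sgrad f A)" and bound: "norm (sgrad f A x) \<le> B" and x_mem: "x \<in> A"
    and z_mem: "z \<in> scone A" "norm z > 1/2"
  shows "norm (sgrad f A z - sgrad f A x) \<le> (4 * L + 2 * B) * norm (z - x)"
proof -
  define g where "g = sgrad f A x"
  have norm_x: "norm x = 1" using x_mem unit by auto
  have norm_z: "1 / norm z \<le> 2" "norm z \<noteq> 0" using z_mem(2) by (auto simp: divide_le_eq)
  have "norm (sgrad f A (sgn z) - g) \<le> L * norm (sgn z - x)"
    unfolding g_def using z_mem(1) x_mem
    by (intro lipschitz_on_normD[OF lip]) (auto simp: mem_scone_iff)
  also have "\<dots> \<le> L * (2 * norm (z - x))"
    using norm_sgn_diff_le[of x z] norm_x lipschitz_on_nonneg[OF lip]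
    by (intro mult_left_mono) (simp_all add: sgn_unit norm_minus_commute)
  finally have sgn_diff_le: "norm (sgrad f A (sgn z) - g) \<le> 2 * L * norm (z - x)" by simp
  have "\<bar>1 - norm z\<bar> \<le> norm (z - x)"
    using norm_triangle_ineq3[of x z] norm_x by (simp add: norm_minus_commute)
  then have size_le: "norm ((1 - norm z) *\<^sub>R g) \<le> norm (z - x) * B"
    using bound by (auto simp: g_def intro!: mult_mono)
  have "sgrad f A z - g = (1 / norm z) *\<^sub>R ((sgrad f A (sgn z) - g) + (1 - norm z) *\<^sub>R g)"
    using norm_z(2) unfolding sgrad_scone[OF full diff z_mem(1)]
    by (simp add: scaleR_diff_right scaleR_diff_left divide_inverse)
  then have "norm (sgrad f A z - g) = 1 / norm z * norm ((sgrad f A (sgn z) - g) + (1 - norm z) *\<^sub>R g)"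
    by simp
  also have "\<dots> \<le> 2 * (2 * L * norm (z - x) + norm (z - x) * B)"
    using norm_z(1) norm_triangle_mono[OF sgn_diff_le size_le] by (intro mult_mono) auto
  finally show ?thesis by (simp add: g_def algebra_simps)
qed

lemma sgrad_derivative_bound:
  assumes domain: "\<Omega> \<subseteq> sphere 0 1" "openin (top_of_set (sphere 0 1)) \<Omega>"
    and diff: "sphere_differentiable_on f \<Omega>" and lip: "L-lipschitz_on \<Omega> (sgrad f \<Omega>)"
    and bound: "norm (sgrad f \<Omega> x) \<le> B" and x_mem: "x \<in> \<Omega>"
    and deriv: "((\<lambda>y. sgrad f \<Omega> y \<bullet> u) has_derivative D) (at x within scone \<Omega>)"
  shows "\<bar>D v\<bar> \<le> (4 * L + 2 * B) * norm u * norm v"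
proof -
  note open_cone = open_scone[OF domain(2)]
  define T where "T = scone \<Omega> \<inter> {z. 1/2 < norm z}"
  have x_cone: "x \<in> scone \<Omega>" "norm x = 1" using x_mem subset_scone[OF domain(1)] domain(1) by auto
  have nbhd: "open T" "x \<in> T"
    unfolding T_def using open_cone x_cone
    by (auto intro!: open_Int open_Collect_less continuous_intros)
  have "norm (D v) \<le> ((4 * L + 2 * B) * norm u) * norm v"
  proof (rule has_derivative_norm_le_of_lipschitz[OF _ nbhd])
    show "((\<lambda>y. sgrad f \<Omega> y \<bullet> u) has_derivative D) (at x)"
      using deriv x_cone(1) open_cone by (metis at_within_open)
    fix z assume z_mem: "z \<in> T"
    have "norm (sgrad f \<Omega> z \<bullet> u - sgrad f \<Omega> x \<bullet> u) \<le> norm (sgrad f \<Omega> z - sgrad f \<Omega> x) * norm u"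
      by (simp flip: inner_diff_left add: Cauchy_Schwarz_ineq2)
    also have "\<dots> \<le> ((4 * L + 2 * B) * norm (z - x)) * norm u"
      using z_mem
      by (intro mult_right_mono
          norm_sgrad_diff_le[OF tangentially_full_open[OF open_cone] domain(1) diff lip bound x_mem])
        (auto simp: T_def)
    finally show "norm (sgrad f \<Omega> z \<bullet> u - sgrad f \<Omega> x \<bullet> u) \<le> (4 * L + 2 * B) * norm u * norm (z - x)"
      by (simp add: mult_ac)
  qed
  then show ?thesis by simp
qed

section \<open>The horospherical map in the projective model\<close>

definition klein_height :: "('a::euclidean_space \<Rightarrow> real) \<Rightarrow> 'a set \<Rightarrow> 'a \<Rightarrow> real" where
  "klein_height f A x = exp (- 2 * f x) * (1 + (norm (sgrad f A x))\<^sup>2)"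

definition klein_shift :: "('a::euclidean_space \<Rightarrow> real) \<Rightarrow> 'a set \<Rightarrow> 'a \<Rightarrow> 'a" where
  "klein_shift f A x =
     (klein_height f A x - 2 * exp (- 2 * f x)) *\<^sub>R x + (2 * exp (- 2 * f x)) *\<^sub>R sgrad f A x"

lemma phi_eq_klein:
  "phi f A x = (exp (f x) / 2) *\<^sub>R (1 + klein_height f A x, x + klein_shift f A x)"
proof -
  define c where "c = exp (f x) / 2 * (1 + klein_height f A x)"
  have "exp (- f x) = exp (f x) * exp (- 2 * f x)" by (simp flip: exp_add)
  then have "phi f A x = (c, c *\<^sub>R x + (exp (f x) * exp (- 2 * f x)) *\<^sub>R (sgrad f A x - x))"
    by (simp add: phi_def Let_def c_def klein_height_def)
  also have "c *\<^sub>R x + (exp (f x) * exp (- 2 * f x)) *\<^sub>R (sgrad f A x - x)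
      = (exp (f x) / 2) *\<^sub>R (x + klein_shift f A x)"
    by (simp add: c_def klein_shift_def algebra_simps add_divide_distrib scaleR_left_distrib)
  finally show ?thesis by (simp add: c_def)
qed

lemma exp_neg_double_add: "exp (- 2 * (a + t)) = exp (- 2 * t) * exp (- 2 * (a::real))"
  by (simp flip: exp_add)

lemma klein_height_add_const:
  "klein_height (\<lambda>x. f x + t) A x = exp (- 2 * t) * klein_height f A x"
  unfolding klein_height_def sgrad_add_const exp_neg_double_add by (rule mult.assoc)

lemma klein_shift_add_const:
  "klein_shift (\<lambda>x. f x + t) A x = exp (- 2 * t) *\<^sub>R klein_shift f A x"
  unfolding klein_shift_def klein_height_add_const sgrad_add_const exp_neg_double_add
  by (simp add: algebra_simps)

lemma phi_in_hyperbolic_space: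
  assumes unit: "A \<subseteq> sphere 0 1" and diff: "sphere_differentiable_on f A" and x_mem: "x \<in> A"
  shows "phi f A x \<in> hyperbolic_space"
proof -
  define s where "s = exp (- 2 * f x)"
  define Q where "Q = klein_height f A x"
  define g where "g = sgrad f A x"
  define k where "k = exp (f x) / 2"
  define X where "X = x + klein_shift f A x"
  have "x \<bullet> x = 1" using unit x_mem by (auto simp: dot_square_norm)
  moreover have "g \<bullet> x = 0"
    unfolding g_def using diff x_mem subset_scone[OF unit]
    by (intro sgrad_tangent hext_differentiable_scone) auto
  moreover have "X = (1 + Q - 2 * s) *\<^sub>R x + (2 * s) *\<^sub>R g"
    by (simp add: X_def klein_shift_def Q_def s_def g_def algebra_simps)
  ultimately have "X \<bullet> X = (1 + Q - 2 * s)\<^sup>2 + 4 * s * (s * (g \<bullet> g))"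
    by (simp add: inner_add_left inner_add_right inner_commute[of x g] power2_eq_square)
  also have "s * (g \<bullet> g) = Q - s"
    by (simp add: Q_def klein_height_def s_def g_def power2_norm_eq_inner algebra_simps)
  also have "(1 + Q - 2 * s)\<^sup>2 + 4 * s * (Q - s) = (1 + Q)\<^sup>2 - 4 * s"
    by (simp add: power2_eq_square algebra_simps)
  finally have "(k *\<^sub>R X) \<bullet> (k *\<^sub>R X) = k\<^sup>2 * ((1 + Q)\<^sup>2 - 4 * s)"
    by (simp add: power2_eq_square)
  also have "\<dots> = (k * (1 + Q))\<^sup>2 - 4 * (k\<^sup>2 * s)"
    by (simp add: power_mult_distrib right_diff_distrib)
  finally have "(k *\<^sub>R X) \<bullet> (k *\<^sub>R X) = (k * (1 + Q))\<^sup>2 - 4 * (k\<^sup>2 * s)" .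
  moreover have "4 * (k\<^sup>2 * s) = 1"
    by (simp add: k_def s_def power2_eq_square flip: exp_add)
  moreover have "k * (1 + Q) > 0"
    unfolding k_def Q_def klein_height_def
    by (intro mult_pos_pos add_pos_nonneg mult_nonneg_nonneg) auto
  moreover have "phi f A x = (k * (1 + Q), k *\<^sub>R X)"
    by (simp add: phi_eq_klein k_def Q_def X_def)
  ultimately show ?thesis by (simp add: hyperbolic_space_def)
qed

lemma hyperbolic_space_norm_less:
  assumes "(a, b) \<in> hyperbolic_space"
  shows "norm b < a"
proof -
  have "(norm b)\<^sup>2 < a\<^sup>2" "a > 0"
    using assms by (auto simp: hyperbolic_space_def power2_norm_eq_inner)
  then show ?thesis by (blast intro: power2_less_imp_less less_imp_le)
qed

lemma phi_add_const_preimage: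
  assumes image: "phi (\<lambda>x. f x + t) A x = (a, b)" and "a > 0"
  shows "x = b /\<^sub>R a + exp (- 2 * t) *\<^sub>R (klein_height f A x *\<^sub>R (b /\<^sub>R a) - klein_shift f A x)"
proof -
  define k where "k = exp (f x + t) / 2"
  have coordinates: "a = k * (1 + exp (- 2 * t) * klein_height f A x)"
      "b = k *\<^sub>R (x + exp (- 2 * t) *\<^sub>R klein_shift f A x)" "k > 0"
    using image by (simp_all add: phi_eq_klein klein_height_add_const klein_shift_add_const k_def)
  define z where "z = b /\<^sub>R a"
  have "b = a *\<^sub>R z" using \<open>a > 0\<close> by (simp add: z_def)
  then have "x + exp (- 2 * t) *\<^sub>R klein_shift f A x = (1 + exp (- 2 * t) * klein_height f A x) *\<^sub>R z"
    unfolding coordinates(1,2) using coordinates(3) by (simp flip: scaleR_scaleR)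
  then show ?thesis by (simp add: algebra_simps flip: z_def)
qed

lemma inj_on_phi_add_const:
  assumes hyp: "phi (\<lambda>x. f x + t) A ` A \<subseteq> hyperbolic_space"
    and lip_height: "L-lipschitz_on A (klein_height f A)"
    and lip_shift: "M-lipschitz_on A (klein_shift f A)"
    and large: "L + M < exp (2 * t)"
  shows "inj_on (phi (\<lambda>x. f x + t) A) A"
proof (rule inj_onI)
  let ?Q = "klein_height f A" and ?W = "klein_shift f A"
  fix x y assume x_mem: "x \<in> A" and y_mem: "y \<in> A"
    and phi_eq: "phi (\<lambda>x. f x + t) A x = phi (\<lambda>x. f x + t) A y"
  obtain a b where phi_x: "phi (\<lambda>x. f x + t) A x = (a, b)" by (cases "phi (\<lambda>x. f x + t) A x")
  have "norm b < a" using hyp x_mem phi_x hyperbolic_space_norm_less[of a b] by force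
  then have "a > 0" using norm_ge_zero[of b] by linarith
  note preimage = phi_add_const_preimage[OF _ \<open>a > 0\<close>]
  define \<epsilon> where "\<epsilon> = exp (- 2 * t)"
  define z where "z = b /\<^sub>R a"
  have z_in_ball: "norm z \<le> 1"
    using \<open>norm b < a\<close> \<open>a > 0\<close> by (simp add: z_def divide_le_eq flip: divide_inverse_commute)
  have "x = z + \<epsilon> *\<^sub>R (?Q x *\<^sub>R z - ?W x)" "y = z + \<epsilon> *\<^sub>R (?Q y *\<^sub>R z - ?W y)"
    unfolding \<epsilon>_def z_def using preimage[OF phi_x] preimage[OF phi_x[unfolded phi_eq]] .
  then have "x - y = (z + \<epsilon> *\<^sub>R (?Q x *\<^sub>R z - ?W x)) - (z + \<epsilon> *\<^sub>R (?Q y *\<^sub>R z - ?W y))"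
    by (rule arg_cong2)
  also have "\<dots> = \<epsilon> *\<^sub>R ((?Q x - ?Q y) *\<^sub>R z - (?W x - ?W y))"
    by (simp add: algebra_simps)
  finally have "norm (x - y) \<le> \<epsilon> * (\<bar>?Q x - ?Q y\<bar> * norm z + norm (?W x - ?W y))"
    using norm_triangle_ineq4[of "(?Q x - ?Q y) *\<^sub>R z"] by (simp add: \<epsilon>_def)
  also have "\<dots> \<le> \<epsilon> * ((L * norm (x - y)) * 1 + M * norm (x - y))"
    using lipschitz_on_normD[OF lip_height x_mem y_mem] lipschitz_on_normD[OF lip_shift x_mem y_mem]
      z_in_ball lipschitz_on_nonneg[OF lip_height]
    by (intro mult_left_mono add_mono mult_mono) (auto simp: \<epsilon>_def)
  finally have "(1 - \<epsilon> * (L + M)) * norm (x - y) \<le> 0" by (simp add: algebra_simps)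
  moreover have "\<epsilon> * (L + M) < \<epsilon> * exp (2 * t)" using large by (simp add: \<epsilon>_def)
  then have "1 - \<epsilon> * (L + M) > 0" by (simp add: \<epsilon>_def flip: exp_add)
  ultimately show "x = y" by (simp add: mult_le_0_iff)
qed

lemma schouten_diag_le:
  "2 * schouten f A x u u \<le> (norm u)\<^sup>2 + (4 * (sgrad f A x \<bullet> u)\<^sup>2 - 2 * shess f A x u u)"
proof -
  have "0 \<le> (norm (sgrad f A x))\<^sup>2 * (norm u)\<^sup>2" "0 \<le> (sgrad f A x \<bullet> u)\<^sup>2" by simp_all
  then show ?thesis
    unfolding schouten_def power2_norm_eq_inner[of u, symmetric] power2_eq_square[of "sgrad f A x \<bullet> u"]
    by (simp add: algebra_simps)
qed

lemma horo_concave_add_const: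
  assumes bound: "\<And>x u. x \<in> A \<Longrightarrow> 2 * exp (- 2 * f x) * schouten f A x u u \<le> C * (norm u)\<^sup>2"
    and large: "C < exp (2 * t)"
  shows "horo_concave (\<lambda>x. f x + t) A"
  unfolding horo_concave_def
proof (intro ballI)
  fix x lam assume x_mem: "x \<in> A" and "lam \<in> schouten_eigenvalues (\<lambda>x. f x + t) A x"
  then obtain u where
    eigenvector: "u \<bullet> x = 0" "u \<noteq> 0" "schouten f A x u u = lam * (exp (2 * (f x + t)) * (u \<bullet> u))"
    unfolding schouten_eigenvalues_def schouten_add_const by blast
  have "2 * lam * exp (2 * t) * (norm u)\<^sup>2 = 2 * exp (- 2 * f x) * schouten f A x u u"
    unfolding eigenvector(3) by (simp add: power2_norm_eq_inner algebra_simps flip: exp_add)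
  also have "\<dots> \<le> C * (norm u)\<^sup>2" using x_mem by (rule bound)
  finally have "2 * lam * exp (2 * t) \<le> C" using eigenvector(2) by simp
  then have "(2 * lam) * exp (2 * t) < 1 * exp (2 * t)" using large by linarith
  then have "2 * lam < 1" by (rule mult_right_less_imp_less) simp
  then show "lam < 1/2" by simp
qed

section \<open>Horospherical data with regular boundary behaviour\<close>

lemma exp_minus_square: "(exp (- a))\<^sup>2 = exp (- 2 * (a::real))"
  by (simp flip: exp_double)

locale horospherical_data = sphere_domain \<Omega> V1 V2
  for \<Omega> V1 V2 :: "'a::euclidean_space set" +
  fixes A :: "'a set" and \<rho> :: "'a \<Rightarrow> real" and \<alpha> :: real
  assumes domain_subset: "\<Omega> \<subseteq> A" "A \<subseteq> closure \<Omega>"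
    and alpha: "0 < \<alpha>" and regular: "c2alpha_on \<alpha> A \<rho>"
    and sq_c11: "c11_closure \<Omega> (\<lambda>x. (exp (- \<rho> x))\<^sup>2)"
    and grad_lipschitz: "\<exists>L. L-lipschitz_on \<Omega> (\<lambda>x. (norm (sgrad (\<lambda>y. exp (- \<rho> y)) \<Omega> x))\<^sup>2)"
begin

lemma A_subset_sphere: "A \<subseteq> sphere 0 1"
  using domain_subset(2) closure_subset_sphere by blast

lemma full: "tangentially_full (scone A)" "tangentially_full (scone \<Omega>)"
  using tangentially_full_scone[OF domain_subset] tangentially_full_open[OF open_scone_domain] by auto

lemma rho_C2: "C2_on_sphere \<rho> A"
  using full(1) A_subset_sphere regular alpha by (rule c2alpha_on_imp_C2_on_sphere)

lemma rho_differentiable: "sphere_differentiable_on \<rho> A" "sphere_differentiable_on \<rho> \<Omega>"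
  using rho_C2 sphere_differentiable_on_subset[OF _ domain_subset(1)] by (auto simp: C2_on_sphere_def)

lemma continuous_on_rho: "continuous_on A \<rho>"
  using rho_differentiable(1) A_subset_sphere by (rule sphere_differentiable_on_imp_continuous_on)

lemma continuous_on_sgrad_rho: "continuous_on A (sgrad \<rho> A)"
  using rho_C2 A_subset_sphere by (rule C2_on_sphere_imp_continuous_on_sgrad)

lemma continuous_on_klein:
  "continuous_on A (klein_height \<rho> A)" "continuous_on A (klein_shift \<rho> A)"
proof -
  show "continuous_on A (klein_height \<rho> A)"
    unfolding klein_height_def by (intro continuous_intros continuous_on_rho continuous_on_sgrad_rho)
  then show "continuous_on A (klein_shift \<rho> A)"
    unfolding klein_shift_def by (intro continuous_intros continuous_on_rho continuous_on_sgrad_rho)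
qed

lemma sgrad_exp_domain:
  assumes x_mem: "x \<in> \<Omega>"
  shows "sgrad (\<lambda>x. exp (c * \<rho> x)) \<Omega> x = (c * exp (c * \<rho> x)) *\<^sub>R sgrad \<rho> A x"
proof -
  have "x \<in> scone \<Omega>" using x_mem subset_scone[OF subset_sphere] by blast
  moreover have "norm x = 1" using x_mem subset_sphere by auto
  ultimately show ?thesis
    using sgrad_exp[OF full(2) rho_differentiable(2)]
      sgrad_subset[OF full(2) domain_subset(1) rho_differentiable(1)] by (simp add: hext_unit)
qed

lemma lipschitz_on_domain_imp_lipschitz_on:
  assumes "L-lipschitz_on \<Omega> f" "continuous_on A f"
  shows "L-lipschitz_on A f"
  using lipschitz_on_dense[OF assms(1) domain_subset assms(2)] .

lemma sigma_sq_lipschitz: "\<exists>L. L-lipschitz_on \<Omega> (\<lambda>x. exp (- 2 * \<rho> x))"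
  using c11_closure_imp_lipschitz[OF sphere_differentiable_on_exp[OF rho_differentiable(2)]] sq_c11
  unfolding exp_minus_square by blast

lemma klein_height_lipschitz_domain: "\<exists>L. L-lipschitz_on \<Omega> (klein_height \<rho> A)"
proof -
  obtain L where lip_sigma_sq: "L-lipschitz_on \<Omega> (\<lambda>x. exp (- 2 * \<rho> x))"
    using sigma_sq_lipschitz by blast
  obtain M where lip_grad: "M-lipschitz_on \<Omega> (\<lambda>x. (norm (sgrad (\<lambda>y. exp (- \<rho> y)) \<Omega> x))\<^sup>2)"
    using grad_lipschitz by blast
  have "(L + M)-lipschitz_on \<Omega> (klein_height \<rho> A)"
  proof (rule lipschitz_on_transform[OF lipschitz_on_add[OF lip_sigma_sq lip_grad]])
    show "klein_height \<rho> A x = exp (- 2 * \<rho> x) + (norm (sgrad (\<lambda>y. exp (- \<rho> y)) \<Omega> x))\<^sup>2" if "x \<in> \<Omega>" for x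
      using sgrad_exp_domain[OF that, of "-1"]
      by (simp add: klein_height_def power_mult_distrib exp_minus_square algebra_simps)
  qed
  then show ?thesis by blast
qed

lemma klein_shift_lipschitz_domain: "\<exists>L. L-lipschitz_on \<Omega> (klein_shift \<rho> A)"
proof -
  obtain L where lip_sigma_sq: "L-lipschitz_on \<Omega> (\<lambda>x. exp (- 2 * \<rho> x))"
    using sigma_sq_lipschitz by blast
  obtain M where lip_height: "M-lipschitz_on \<Omega> (klein_height \<rho> A)"
    using klein_height_lipschitz_domain by blast
  have "bounded \<Omega>" using subset_sphere bounded_subset bounded_sphere by blast
  then obtain K where
    lip_radial: "K-lipschitz_on \<Omega> (\<lambda>x. (klein_height \<rho> A x - 2 * exp (- 2 * \<rho> x)) *\<^sub>R x)"
    using lipschitz_on_scaleR[OF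
      lipschitz_on_diff[OF lip_height lipschitz_on_cmult_real[OF lip_sigma_sq, of 2]] lipschitz_on_id]
    by blast
  obtain N where lip_grad: "N-lipschitz_on \<Omega> (sgrad (\<lambda>x. exp (- 2 * \<rho> x)) \<Omega>)"
    using sq_c11 unfolding c11_closure_def exp_minus_square by blast
  have "(K + N)-lipschitz_on \<Omega> (klein_shift \<rho> A)"
  proof (rule lipschitz_on_transform[OF lipschitz_on_diff[OF lip_radial lip_grad]])
    show "klein_shift \<rho> A x =
        (klein_height \<rho> A x - 2 * exp (- 2 * \<rho> x)) *\<^sub>R x - sgrad (\<lambda>x. exp (- 2 * \<rho> x)) \<Omega> x"
      if "x \<in> \<Omega>" for x
      using sgrad_exp_domain[OF that, of "-2"] by (simp add: klein_shift_def)
  qed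
  then show ?thesis by blast
qed

lemma klein_lipschitz:
  obtains L M where "L-lipschitz_on A (klein_height \<rho> A)" "M-lipschitz_on A (klein_shift \<rho> A)"
  using klein_height_lipschitz_domain klein_shift_lipschitz_domain
    lipschitz_on_domain_imp_lipschitz_on continuous_on_klein by metis

lemma sigma_sq_bounded:
  obtains S where "\<And>x. x \<in> A \<Longrightarrow> exp (- 2 * \<rho> x) \<le> S"
proof -
  obtain L where "L-lipschitz_on A (\<lambda>x. exp (- 2 * \<rho> x))"
    using sigma_sq_lipschitz lipschitz_on_domain_imp_lipschitz_on continuous_on_rho
    by (metis (no_types) continuous_on_exp continuous_on_mult_left)
  moreover have "bounded A" using A_subset_sphere bounded_subset bounded_sphere by blast
  ultimately have "bounded ((\<lambda>x. exp (- 2 * \<rho> x)) ` A)" by (rule lipschitz_on_imp_bounded_image)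
  then show ?thesis using that by (auto simp: bounded_iff)
qed

lemma has_derivative_sgrad_sigma_sq:
  assumes x_mem: "x \<in> \<Omega>"
  shows "((\<lambda>y. sgrad (\<lambda>x. exp (- 2 * \<rho> x)) \<Omega> y \<bullet> u) has_derivative
      (\<lambda>v. exp (- 2 * \<rho> x) * (4 * (sgrad \<rho> A x \<bullet> u) * (sgrad \<rho> A x \<bullet> v) - 2 * shess \<rho> A x u v)))
    (at x within scone \<Omega>)"
proof -
  have x_cone: "x \<in> scone \<Omega>" "x \<in> A" "x \<in> scone A" "norm x = 1"
    using x_mem domain_subset subset_scone[OF subset_sphere] subset_scone[OF A_subset_sphere]
      subset_sphere by auto
  have grad: "sgrad \<rho> \<Omega> y = sgrad \<rho> A y" if "y \<in> scone \<Omega>" for y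
    using sgrad_subset[OF full(2) domain_subset(1) rho_differentiable(1) that] .
  then have grad_inner: "sgrad \<rho> \<Omega> y \<bullet> u = sgrad \<rho> A y \<bullet> u" if "y \<in> scone \<Omega>" for y
    using that by simp
  have "((\<lambda>y. sgrad \<rho> A y \<bullet> u) has_derivative shess \<rho> A x u) (at x within scone \<Omega>)"
    using has_derivative_subset[OF has_derivative_sgrad_inner scone_mono[OF domain_subset(1)]]
      rho_C2 x_cone by (simp add: C2_on_sphere_def)
  from has_derivative_transform[OF x_cone(1) grad_inner this]
  have "((\<lambda>y. sgrad \<rho> \<Omega> y \<bullet> u) has_derivative shess \<rho> A x u) (at x within scone \<Omega>)" .
  from has_derivative_sgrad_exp[OF full(2) rho_differentiable(2) x_cone(1) this, of "-2"]
  show ?thesis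
    using grad[OF x_cone(1)] x_cone(4) by (simp add: hext_unit)
qed

lemma sigma_sq_hessian_bounded:
  obtains C where "\<And>x u. x \<in> A \<Longrightarrow>
    exp (- 2 * \<rho> x) * (4 * (sgrad \<rho> A x \<bullet> u)\<^sup>2 - 2 * shess \<rho> A x u u) \<le> C * (norm u)\<^sup>2"
proof -
  obtain L where lip: "L-lipschitz_on \<Omega> (sgrad (\<lambda>x. exp (- 2 * \<rho> x)) \<Omega>)"
    using sq_c11 unfolding c11_closure_def exp_minus_square by blast
  obtain B where bound: "\<And>x. x \<in> \<Omega> \<Longrightarrow> norm (sgrad (\<lambda>x. exp (- 2 * \<rho> x)) \<Omega> x) \<le> B"
    using lipschitz_on_imp_bounded_image[OF lip bounded_subset[OF bounded_sphere subset_sphere]]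
    by (auto simp: bounded_iff)
  define h where "h u x = exp (- 2 * \<rho> x) * (4 * (sgrad \<rho> A x \<bullet> u)\<^sup>2 - 2 * shess \<rho> A x u u)" for u x
  have domain: "h u x \<le> (4 * L + 2 * B) * (norm u)\<^sup>2" if x_mem: "x \<in> \<Omega>" for x u
    using sgrad_derivative_bound[OF subset_sphere open_in_sphere
        sphere_differentiable_on_exp[OF rho_differentiable(2)] lip bound[OF x_mem] x_mem
        has_derivative_sgrad_sigma_sq[OF x_mem], of u u]
    by (simp add: h_def power2_eq_square mult_ac abs_le_iff)
  have "h u x \<le> (4 * L + 2 * B) * (norm u)\<^sup>2" if "x \<in> A" for x u
  proof (rule continuous_le_on_dense[OF _ domain_subset domain that])
    have "continuous_on A (\<lambda>x. shess \<rho> A x u u)" using rho_C2 by (simp add: C2_on_sphere_def)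
    then show "continuous_on A (h u)"
      unfolding h_def by (intro continuous_intros continuous_on_rho continuous_on_sgrad_rho)
  qed
  then show ?thesis using that unfolding h_def by blast
qed

lemma schouten_bounded:
  obtains C where "\<And>x u. x \<in> A \<Longrightarrow> 2 * exp (- 2 * \<rho> x) * schouten \<rho> A x u u \<le> C * (norm u)\<^sup>2"
proof -
  obtain S where sigma_sq_le: "\<And>x. x \<in> A \<Longrightarrow> exp (- 2 * \<rho> x) \<le> S"
    using sigma_sq_bounded by blast
  obtain C where hessian_le: "\<And>x u. x \<in> A \<Longrightarrow>
      exp (- 2 * \<rho> x) * (4 * (sgrad \<rho> A x \<bullet> u)\<^sup>2 - 2 * shess \<rho> A x u u) \<le> C * (norm u)\<^sup>2"
    using sigma_sq_hessian_bounded by blast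
  have "2 * exp (- 2 * \<rho> x) * schouten \<rho> A x u u \<le> (S + C) * (norm u)\<^sup>2" if x_mem: "x \<in> A" for x u
  proof -
    have "exp (- 2 * \<rho> x) * (2 * schouten \<rho> A x u u) \<le>
        exp (- 2 * \<rho> x) * ((norm u)\<^sup>2 + (4 * (sgrad \<rho> A x \<bullet> u)\<^sup>2 - 2 * shess \<rho> A x u u))"
      using schouten_diag_le by (rule mult_left_mono) simp
    also have "\<dots> = exp (- 2 * \<rho> x) * (norm u)\<^sup>2
        + exp (- 2 * \<rho> x) * (4 * (sgrad \<rho> A x \<bullet> u)\<^sup>2 - 2 * shess \<rho> A x u u)"
      by (rule distrib_left)
    also have "\<dots> \<le> S * (norm u)\<^sup>2 + C * (norm u)\<^sup>2"
      using sigma_sq_le[OF x_mem] hessian_le[OF x_mem] by (intro add_mono mult_right_mono) auto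
    finally show ?thesis by (simp add: algebra_simps)
  qed
  then show ?thesis using that by blast
qed

lemma phi_add_const_in_hyperbolic_space: "phi (\<lambda>x. \<rho> x + t) A ` A \<subseteq> hyperbolic_space"
proof -
  have "sphere_differentiable_on (\<lambda>x. \<rho> x + t) A"
    using rho_differentiable(1) by (simp add: sphere_differentiable_on_def hext_add_const)
  then show ?thesis using phi_in_hyperbolic_space[OF A_subset_sphere] by blast
qed

end

theorem mainTheorem5:
  fixes \<Omega> V1 V2 :: "'a::euclidean_space set" and \<rho> :: "'a \<Rightarrow> real" and \<alpha> :: real
  assumes dim: "DIM('a) \<ge> 4"
    and dom_sub: "\<Omega> \<subseteq> sphere 0 1"
    and dom_open: "openin (top_of_set (sphere 0 1)) \<Omega>"
    and dom_conn: "connected \<Omega>" and dom_ne: "\<Omega> \<noteq> {}"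
    and bdry: "closure \<Omega> - \<Omega> = V1 \<union> V2"
    and disj: "V1 \<inter> V2 = {}"
    and V1: "compact_submanifold_of_sphere V1"
    and V2: "compact_submanifold_of_sphere V2"
    and alpha: "0 < \<alpha>" "\<alpha> < 1"
    and reg: "c2alpha_on \<alpha> (\<Omega> \<union> V1) \<rho>"
    and h1: "c11_closure \<Omega> (\<lambda>x. (exp (- \<rho> x))\<^sup>2)"
    and h2: "\<exists>L. L-lipschitz_on \<Omega> (\<lambda>x. (norm (sgrad (\<lambda>y. exp (- \<rho> y)) \<Omega> x))\<^sup>2)"
  shows "\<exists>t0>0. \<forall>t>t0.
           phi (\<lambda>x. \<rho> x + t) (\<Omega> \<union> V1) ` (\<Omega> \<union> V1) \<subseteq> hyperbolic_space \<and>
           horo_concave (\<lambda>x. \<rho> x + t) (\<Omega> \<union> V1) \<and>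
           inj_on (phi (\<lambda>x. \<rho> x + t) (\<Omega> \<union> V1)) (\<Omega> \<union> V1)"
proof -
  have sub: "\<Omega> \<subseteq> \<Omega> \<union> V1" "\<Omega> \<union> V1 \<subseteq> closure \<Omega>" using bdry closure_subset[of \<Omega>] by auto
  interpret horospherical_data \<Omega> V1 V2 "\<Omega> \<union> V1" \<rho> \<alpha>
    by unfold_locales (fact assms sub)+
  obtain L M where lip: "L-lipschitz_on (\<Omega> \<union> V1) (klein_height \<rho> (\<Omega> \<union> V1))"
      "M-lipschitz_on (\<Omega> \<union> V1) (klein_shift \<rho> (\<Omega> \<union> V1))"
    by (rule klein_lipschitz)
  obtain C where schouten_le: "\<And>x u. x \<in> \<Omega> \<union> V1 \<Longrightarrow>
      2 * exp (- 2 * \<rho> x) * schouten \<rho> (\<Omega> \<union> V1) x u u \<le> C * (norm u)\<^sup>2"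
    using schouten_bounded by blast
  define t0 where "t0 = 1 + L + M + \<bar>C\<bar>"
  have nonneg: "L \<ge> 0" "M \<ge> 0" using lip lipschitz_on_nonneg by auto
  have "t0 > 0" using nonneg by (simp add: t0_def)
  moreover have large: "L + M < exp (2 * t)" "C < exp (2 * t)" if "t > t0" for t
    using that nonneg exp_ge_add_one_self[of "2 * t"] unfolding t0_def by linarith+
  moreover note horo_concave_add_const[OF schouten_le] phi_add_const_in_hyperbolic_space
    inj_on_phi_add_const[OF phi_add_const_in_hyperbolic_space lip]
  ultimately show ?thesis by blast
qed

end
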